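(* For every countable group $G$, $SR(\mathbb{C}G)=RR(\mathbb{C}G)$.
   Context: Let $A$ be a unital $\mathbb{C}$-algebra. For a finite-dimensional subspace $L\subseteq A$ with $1\in L$ and $\varepsilon>0$, an $\varepsilon$-almost representation of $L$ is a linear map $\psi:L\to\operatorname{End}_{\mathbb{C}}(V)$, $V$ finite-dimensional, with $\psi(1)=\mathrm{Id}$, such that there is a subspace $V_\varepsilon\subseteq V$ with $\dim V-\dim V_\varepsilon<\varepsilon\dim V$ and $\psi(a)\psi(b)v=\psi(ab)v$ for all $a,b\in L$ with $ab\in L$ and all $v\in V_\varepsilon$. $A$ has almost finite dimensional representations if every such $L$ has an $\varepsilon$-almost representation for every $\varepsilon>0$. Rank radical $RR(A)$: if $A$ lacks almost finite dimensional representations, $RR(A)=A$; otherwise $p\in RR(A)$ iff there exists a finite-dimensional subspace $L$ with $\{1,p\}\subseteq L\subseteq A$ such that for every $\delta>0$ there is $\eta>0$ such that for every $0<\varepsilon<\eta$ and every $\varepsilon$-almost representation $\psi:L\to\operatorname{End}(V)$, $\dim\operatorname{Ran}\psi(p)<\delta\dim V$. Sofic radical $SR(A)$: if $A$ lacks almost finite dimensional representations, $SR(A)=A$; otherwise $p\in SR(A)$ iff for every $\delta>0$ there exist a finite-dimensional subspace $L$ with $\{1,p\}\subseteq L\subseteq A$ and $\eta>0$ such that for every $0<\varepsilon<\eta$ and every $\varepsilon$-almost representation $\psi:L\to\operatorname{End}(V)$, $\dim\operatorname{Ran}\psi(p)<\delta\dim V$. *)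

theory Defs
  imports "HOL-Library.Poly_Mapping" "HOL-Library.Countable" "Jordan_Normal_Form.DL_Rank"
begin

text \<open>A unital complex algebra is modelled as a type 'a of class ring_1 together with
  a scalar multiplication by complex numbers. Finite-dimensional vector spaces V are
  modelled as complex^n (carrier_vec n), and End(V) as n x n complex matrices.\<close>

definition fd_subspace :: "(complex \<Rightarrow> 'a::ring_1 \<Rightarrow> 'a) \<Rightarrow> 'a set \<Rightarrow> bool" where
  "fd_subspace scale L \<longleftrightarrow> module.subspace scale L \<and> (\<exists>B. finite B \<and> module.span scale B = L)"

definition cdim_sub :: "nat \<Rightarrow> complex vec set \<Rightarrow> nat" where
  "cdim_sub n W = vectorspace.dim class_ring ((module_vec TYPE(complex) n)\<lparr>carrier := W\<rparr>)"

definition almost_rep ::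
  "(complex \<Rightarrow> 'a::ring_1 \<Rightarrow> 'a) \<Rightarrow> 'a set \<Rightarrow> real \<Rightarrow> nat \<Rightarrow> ('a \<Rightarrow> complex mat) \<Rightarrow> bool" where
  "almost_rep scale L \<epsilon> n \<psi> \<longleftrightarrow>
     (\<forall>a\<in>L. \<psi> a \<in> carrier_mat n n) \<and>
     (\<forall>a\<in>L. \<forall>b\<in>L. \<psi> (a + b) = \<psi> a + \<psi> b) \<and>
     (\<forall>c. \<forall>a\<in>L. \<psi> (scale c a) = c \<cdot>\<^sub>m \<psi> a) \<and>
     \<psi> 1 = 1\<^sub>m n \<and>
     (\<exists>W. subspace class_ring W (module_vec TYPE(complex) n) \<and>
          real n - real (cdim_sub n W) < \<epsilon> * real n \<and>
          (\<forall>a\<in>L. \<forall>b\<in>L. a * b \<in> L \<longrightarrow>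
             (\<forall>v\<in>W. \<psi> a *\<^sub>v (\<psi> b *\<^sub>v v) = \<psi> (a * b) *\<^sub>v v)))"

definition has_afdr :: "(complex \<Rightarrow> 'a::ring_1 \<Rightarrow> 'a) \<Rightarrow> bool" where
  "has_afdr scale \<longleftrightarrow>
     (\<forall>L. fd_subspace scale L \<and> 1 \<in> L \<longrightarrow>
        (\<forall>\<epsilon>>0. \<exists>n \<psi>. almost_rep scale L \<epsilon> n \<psi>))"

definition ran_dim :: "nat \<Rightarrow> complex mat \<Rightarrow> nat" where
  "ran_dim n M = vec_space.rank n M"

definition rank_radical :: "(complex \<Rightarrow> 'a::ring_1 \<Rightarrow> 'a) \<Rightarrow> 'a set" where
  "rank_radical scale =
    (if \<not> has_afdr scale then UNIV else
     {p. \<exists>L. fd_subspace scale L \<and> 1 \<in> L \<and> p \<in> L \<and>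
          (\<forall>\<delta>>0. \<exists>\<eta>>0. \<forall>\<epsilon>. 0 < \<epsilon> \<and> \<epsilon> < \<eta> \<longrightarrow>
             (\<forall>n \<psi>. almost_rep scale L \<epsilon> n \<psi> \<longrightarrow> real (ran_dim n (\<psi> p)) < \<delta> * real n))})"

definition sofic_radical :: "(complex \<Rightarrow> 'a::ring_1 \<Rightarrow> 'a) \<Rightarrow> 'a set" where
  "sofic_radical scale =
    (if \<not> has_afdr scale then UNIV else
     {p. \<forall>\<delta>>0. \<exists>L \<eta>. fd_subspace scale L \<and> 1 \<in> L \<and> p \<in> L \<and> \<eta> > 0 \<and>
          (\<forall>\<epsilon>. 0 < \<epsilon> \<and> \<epsilon> < \<eta> \<longrightarrow>
             (\<forall>n \<psi>. almost_rep scale L \<epsilon> n \<psi> \<longrightarrow> real (ran_dim n (\<psi> p)) < \<delta> * real n))})"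

text \<open>Group algebra CG of a group 'g (written additively, class group_add, not necessarily
  commutative): finitely supported functions 'g \<Rightarrow> complex with convolution product
  (the ring_1 instance of poly_mapping) and pointwise scalar multiplication.\<close>

definition cg_scale :: "complex \<Rightarrow> ('g::group_add \<Rightarrow>\<^sub>0 complex) \<Rightarrow> ('g \<Rightarrow>\<^sub>0 complex)" where
  "cg_scale c a = Poly_Mapping.map (\<lambda>x. c * x) a"

end

theory Submission
  imports Defs
begin

text \<open>The radicals differ only in whether \<open>L\<close> may depend on \<open>\<delta>\<close>. If \<open>g - h\<close> is not in
  the rank radical, tensor powers of almost representations push the relative rank of
  \<open>\<phi> g - \<phi> h\<close> to at least \<open>1/4\<close>, a bound independent of \<open>L\<close>. If this happens for a fixed \<open>g\<close>
  in the support of \<open>p\<close> and every other \<open>h\<close> there, then tensoring successively with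
  \<open>1 \<oplus> \<phi>\<close> gives almost representations in which \<open>p\<close> has relative rank bounded below independently
  of \<open>L\<close>, so \<open>p\<close> is not in the sofic radical. Otherwise some \<open>g - h\<close> lies in the rank radical and
  subtracting a multiple of it from \<open>p\<close> shrinks the support, so induction on the support applies.\<close>

section \<open>Rank via factorizations\<close>

text \<open>The obstacle is the order of quantifiers. Failure to lie in the rank radical yields, for
  each finite \<open>F\<close>, some \<open>d\<close> that may shrink as \<open>F\<close> grows,
  whereas failure to lie in the sofic radical requires one \<open>d\<close> for all
  \<open>F\<close>. Differences \<open>g - h\<close> can be amplified: if \<open>r\<close> is the
  relative rank of \<open>\<phi> g - \<phi> h\<close> and \<open>\<phi> g\<close> is nearly
  invertible, the tensor square has relative rank at least about \<open>2 r (1 - r)\<close>, which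
  beats \<open>r\<close> by a fixed factor while \<open>r < 1/4\<close>. The number of squarings
  depends on \<open>d\<close>, hence on \<open>F\<close>, but the error merely doubles each time and
  can be made small in advance. A general \<open>p\<close> cannot be squared like this, since
  \<open>g \<mapsto> \<phi> g \<otimes> \<phi> g\<close> does not send \<open>p\<close> to a
  function of its old image; its bound is assembled from differences. On the way the coefficients of
  \<open>p\<close> get replaced by other ones, so the bound must hold at once for all elements with
  given support and nonzero coefficient at \<open>g\<close>. Finally, working with maps on the group
  whose defects have small rank turns every estimate into an inequality between matrix
  ranks.\<close>

text \<open>Here and in the following lemmas, equations between \<open>dim_row\<close> and
  \<open>dim_col\<close> replace carrier sets, so that the conclusions become rewrite rules whose
  side conditions can be simplified away without guessing sizes.\<close>

lemma mat_assoc: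
  fixes A B C :: "'a::semiring_0 mat"
  assumes "dim_col A = dim_row B" "dim_col B = dim_row C"
  shows "A * B * C = A * (B * C)"
  using assms by (intro assoc_mult_mat[of _ "dim_row A" "dim_col A" _ "dim_col B" _ "dim_col C"]) auto

lemma mat_add_mult:
  fixes A B C :: "'a::semiring_0 mat"
  assumes "dim_row A = dim_row B" "dim_col A = dim_col B" "dim_col B = dim_row C"
  shows "(A + B) * C = A * C + B * C"
  using assms by (intro add_mult_distrib_mat[of _ "dim_row A" "dim_col A" _ _ "dim_col C"]) auto

lemma mat_mult_add:
  fixes A B C :: "'a::semiring_0 mat"
  assumes "dim_col A = dim_row B" "dim_row B = dim_row C" "dim_col B = dim_col C"
  shows "A * (B + C) = A * B + A * C"
  using assms by (intro mult_add_distrib_mat[of _ "dim_row A" "dim_col A" _ "dim_col C"]) auto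

lemma mat_minus_mult:
  fixes A B C :: "'a::ring mat"
  assumes "dim_row A = dim_row B" "dim_col A = dim_col B" "dim_col B = dim_row C"
  shows "(A - B) * C = A * C - B * C"
  using assms by (intro minus_mult_distrib_mat[of _ "dim_row A" "dim_col A" _ _ "dim_col C"]) auto

lemma mat_mult_minus:
  fixes A B C :: "'a::ring mat"
  assumes "dim_col A = dim_row B" "dim_row B = dim_row C" "dim_col B = dim_col C"
  shows "A * (B - C) = A * B - A * C"
  using assms by (intro mult_minus_distrib_mat[of _ "dim_row A" "dim_col A" _ "dim_col C"]) auto

lemma mat_one_mult: "dim_row A = n \<Longrightarrow> 1\<^sub>m n * A = (A :: 'a::semiring_1 mat)"
  by (intro left_mult_one_mat[of _ n "dim_col A"]) auto

lemma mat_mult_one: "dim_col A = n \<Longrightarrow> A * 1\<^sub>m n = (A :: 'a::semiring_1 mat)"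
  by (intro right_mult_one_mat[of _ "dim_row A" n]) auto

lemma mat_zero_mult: "dim_row A = m \<Longrightarrow> 0\<^sub>m n m * A = 0\<^sub>m n (dim_col (A :: 'a::semiring_0 mat))"
  by (intro left_mult_zero_mat[of _ m "dim_col A"]) auto

lemma mat_mult_zero: "dim_col A = m \<Longrightarrow> A * 0\<^sub>m m n = 0\<^sub>m (dim_row (A :: 'a::semiring_0 mat)) n"
  by (intro right_mult_zero_mat[of _ "dim_row A" m]) auto

lemma mat_minus_self: "A - A = 0\<^sub>m (dim_row A) (dim_col (A :: 'a::group_add mat))"
  by (rule eq_matI) auto

lemma mat_minus_zero: "dim_row A = n \<Longrightarrow> dim_col A = m \<Longrightarrow> A - 0\<^sub>m n m = (A :: 'a::group_add mat)"
  by (rule eq_matI) auto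

lemma mat_add_minus:
  assumes "dim_row A = dim_row B" "dim_col A = dim_col B"
  shows "A + (B - A) = (B :: 'a::ab_group_add mat)"
  using assms by (intro eq_matI) auto

lemmas mat_simps = mat_assoc mat_add_mult mat_mult_add mat_minus_mult mat_mult_minus
  mat_one_mult mat_mult_one mat_zero_mult mat_mult_zero mat_minus_self mat_minus_zero

section \<open>Horizontal and vertical concatenation of matrices\<close>

definition append_cols :: "'a::zero mat \<Rightarrow> 'a mat \<Rightarrow> 'a mat" (infixr "@\<^sub>c" 65) where
  "A @\<^sub>c B = four_block_mat A B (0\<^sub>m 0 (dim_col A)) (0\<^sub>m 0 (dim_col B))"

lemma dim_append_cols [simp]:
  "dim_row (A @\<^sub>c B) = dim_row A" "dim_col (A @\<^sub>c B) = dim_col A + dim_col B"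
  by (auto simp: append_cols_def)

lemma dim_append_rows [simp]:
  "dim_row (A @\<^sub>r B) = dim_row A + dim_row B" "dim_col (A @\<^sub>r B) = dim_col A"
  by (auto simp: append_rows_def)

lemma append_cols_mult_append_rows:
  fixes A B C D :: "'a::semiring_0 mat"
  assumes "dim_row A = dim_row B" "dim_col A = dim_row C" "dim_col B = dim_row D" "dim_col C = dim_col D"
  shows "(A @\<^sub>c B) * (C @\<^sub>r D) = A * C + B * D"
proof -
  have "(A @\<^sub>c B) * (C @\<^sub>r D) =
    four_block_mat (A * C + B * D) (A * 0\<^sub>m (dim_row C) 0 + B * 0\<^sub>m (dim_row D) 0)
      (0\<^sub>m 0 (dim_col A) * C + 0\<^sub>m 0 (dim_col B) * D)
      (0\<^sub>m 0 (dim_col A) * 0\<^sub>m (dim_row C) 0 + 0\<^sub>m 0 (dim_col B) * 0\<^sub>m (dim_row D) 0)"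
    unfolding append_cols_def append_rows_def using assms
    by (intro mult_four_block_mat[of _ "dim_row A" "dim_col A" _ "dim_col B" _ 0 _ _ "dim_col C" _ 0]) auto
  also have "\<dots> = A * C + B * D"
    using assms by (intro eq_matI) auto
  finally show ?thesis .
qed

lemma append_rows_mult_append_cols:
  fixes A B C D :: "'a::semiring_0 mat"
  assumes "dim_col A = dim_col B" "dim_col A = dim_row C" "dim_row C = dim_row D"
  shows "(A @\<^sub>r B) * (C @\<^sub>c D) = four_block_mat (A * C) (A * D) (B * C) (B * D)"
proof -
  have "(A @\<^sub>r B) * (C @\<^sub>c D) =
    four_block_mat (A * C + 0\<^sub>m (dim_row A) 0 * 0\<^sub>m 0 (dim_col C))
       (A * D + 0\<^sub>m (dim_row A) 0 * 0\<^sub>m 0 (dim_col D))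
       (B * C + 0\<^sub>m (dim_row B) 0 * 0\<^sub>m 0 (dim_col C))
       (B * D + 0\<^sub>m (dim_row B) 0 * 0\<^sub>m 0 (dim_col D))"
    unfolding append_cols_def append_rows_def using assms
    by (intro mult_four_block_mat[of _ "dim_row A" "dim_col A" _ 0 _ "dim_row B" _ _ "dim_col C" _ "dim_col D"]) auto
  also have "\<dots> = four_block_mat (A * C) (A * D) (B * C) (B * D)"
    using assms by (intro cong_four_block_mat) (auto intro!: eq_matI)
  finally show ?thesis .
qed

section \<open>Full rank factorizations and rank inequalities\<close>

text \<open>If \<open>k < n\<close>, padding \<open>U\<close> and \<open>V\<close> with zeros to
  square matrices keeps the product \<open>1\<close>, so the padded factors also multiply to
  \<open>1\<close> in the other order; but the last row of the padded \<open>V\<close> is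
  zero.\<close>

lemma one_mat_factor_le:
  fixes U V :: "'a::field mat"
  assumes U: "U \<in> carrier_mat n k" and V: "V \<in> carrier_mat k n" and UV: "U * V = 1\<^sub>m n"
  shows "n \<le> k"
proof (rule ccontr)
  assume "\<not> n \<le> k"
  then have k: "k < n" by simp
  define U' where "U' = U @\<^sub>c 0\<^sub>m n (n - k)"
  define V' where "V' = V @\<^sub>r 0\<^sub>m (n - k) n"
  have cU: "U' \<in> carrier_mat n n" and cV: "V' \<in> carrier_mat n n"
    unfolding U'_def V'_def using carrier_matD[OF U] carrier_matD[OF V] k by (intro carrier_matI; simp)+
  have "U' * V' = U * V + 0\<^sub>m n (n - k) * 0\<^sub>m (n - k) n"
    unfolding U'_def V'_def using carrier_matD[OF U] carrier_matD[OF V] k by (intro append_cols_mult_append_rows) auto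
  then have "U' * V' = 1\<^sub>m n" using UV by (simp add: mat_simps)
  then have VU: "V' * U' = 1\<^sub>m n" by (rule mat_mult_left_right_inverse[OF cU cV])
  have "row V' (n - 1) = 0\<^sub>v n"
    using k carrier_matD[OF V] by (intro eq_vecI) (auto simp: V'_def append_rows_def)
  then have "(V' * U') $$ (n - 1, n - 1) = 0"
    using cU cV k by (simp add: scalar_prod_def)
  then show False using VU k by simp
qed

lemma sum_delta_mult:
  fixes f :: "nat \<Rightarrow> 'a::semiring_0"
  assumes "i < n"
  shows "(\<Sum>l = 0..<n. (if l = i then a else 0) * f l) = a * f i"
    "(\<Sum>l = 0..<n. f l * (if l = i then a else 0)) = f i * a"
proof -
  have "(\<Sum>l = 0..<n. (if l = i then a else 0) * f l) = (\<Sum>l = 0..<n. if l = i then a * f i else 0)"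
    by (intro sum.cong) auto
  then show "(\<Sum>l = 0..<n. (if l = i then a else 0) * f l) = a * f i" using assms by simp
  have "(\<Sum>l = 0..<n. f l * (if l = i then a else 0)) = (\<Sum>l = 0..<n. if l = i then f i * a else 0)"
    by (intro sum.cong) auto
  then show "(\<Sum>l = 0..<n. f l * (if l = i then a else 0)) = f i * a" using assms by simp
qed

text \<open>Elimination by rank one pieces, by induction on the number of nonzero columns. The
  one-sided inverses \<open>P\<close> and \<open>Q\<close> are carried along because they certify
  that \<open>r\<close> is minimal.\<close>

theorem full_rank_factorization:
  fixes A :: "'a::field mat"
  assumes "A \<in> carrier_mat n m"
  shows "\<exists>r U V P Q. U \<in> carrier_mat n r \<and> V \<in> carrier_mat r m \<and> P \<in> carrier_mat r n \<and>
    Q \<in> carrier_mat m r \<and> A = U * V \<and> P * U = 1\<^sub>m r \<and> V * Q = 1\<^sub>m r"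
  using assms
proof (induction "card {j. j < m \<and> (\<exists>i<n. A $$ (i,j) \<noteq> 0)}" arbitrary: A rule: less_induct)
  case less
  note A = carrier_matD[OF less.prems]
  show ?case
  proof (cases "\<exists>i<n. \<exists>j<m. A $$ (i,j) \<noteq> 0")
    case False
    then have "A = 0\<^sub>m n 0 * 0\<^sub>m 0 m" using A by (intro eq_matI) (auto simp: scalar_prod_def)
    moreover have "0\<^sub>m 0 n * 0\<^sub>m n 0 = (1\<^sub>m 0 :: 'a mat)" "0\<^sub>m 0 m * 0\<^sub>m m 0 = (1\<^sub>m 0 :: 'a mat)"
      by auto
    ultimately show ?thesis by (metis zero_carrier_mat)
  next
    case True
    then obtain i0 j0 where ij: "i0 < n" "j0 < m" "A $$ (i0,j0) \<noteq> 0" by blast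
    let ?a = "A $$ (i0,j0)"
    \<comment> \<open>\<open>c * w\<close> agrees with \<open>A\<close> on the pivot row and the
      pivot column, so \<open>A - c * w\<close> vanishes there, and zero columns stay zero. The
      vectors \<open>s\<close> and \<open>t\<close> read off the pivot row and column, normalised to
      be one-sided inverses of \<open>c\<close> and \<open>w\<close>.\<close>
    define c where "c = mat n 1 (\<lambda>(i,j). A $$ (i,j0))"
    define w where "w = mat 1 m (\<lambda>(i,j). A $$ (i0,j) / ?a)"
    define s where "s = mat 1 n (\<lambda>(i,j). if j = i0 then 1 / ?a else 0)"
    define t where "t = mat m 1 (\<lambda>(i,j). if i = j0 then 1 else (0::'a))"
    have d [simp]: "dim_row c = n" "dim_col c = 1" "dim_row w = 1" "dim_col w = m"
      "dim_row s = 1" "dim_col s = n" "dim_row t = m" "dim_col t = 1"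
      "dim_row A = n" "dim_col A = m"
      using A by (auto simp: c_def w_def s_def t_def)
    have cw: "(c * w) $$ (i,j) = A $$ (i,j0) * A $$ (i0,j) / ?a" if "i < n" "j < m" for i j
      using that by (simp add: c_def w_def scalar_prod_def)
    define A' where "A' = A - c * w"
    have cA': "A' \<in> carrier_mat n m" unfolding A'_def by (intro carrier_matI) simp_all
    have A': "A' $$ (i,j) = A $$ (i,j) - A $$ (i,j0) * A $$ (i0,j) / ?a" if "i < n" "j < m" for i j
      using that by (simp add: A'_def cw del: index_mult_mat(1))
    have sc: "s * c = 1\<^sub>m 1"
      using ij by (intro eq_matI) (auto simp: s_def c_def scalar_prod_def sum_delta_mult)
    have wt: "w * t = 1\<^sub>m 1"
      using ij by (intro eq_matI) (auto simp: t_def w_def scalar_prod_def sum_delta_mult sum_divide_distrib[symmetric])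
    have sA': "s * A' = 0\<^sub>m 1 m"
    proof (rule eq_matI)
      fix i j assume "i < dim_row (0\<^sub>m 1 m :: 'a mat)" "j < dim_col (0\<^sub>m 1 m :: 'a mat)"
      then have i: "i = 0" and j: "j < m" by auto
      have "(s * A') $$ (i,j) = 1 / ?a * A' $$ (i0,j)"
        using i j ij carrier_matD[OF cA'] by (simp add: s_def scalar_prod_def sum_delta_mult)
      also have "\<dots> = 0" using ij j by (simp add: A')
      finally show "(s * A') $$ (i,j) = 0\<^sub>m 1 m $$ (i,j)" using i j by simp
    qed (use cA' in auto)
    have A't: "A' * t = 0\<^sub>m n 1"
    proof (rule eq_matI)
      fix i j assume "i < dim_row (0\<^sub>m n 1 :: 'a mat)" "j < dim_col (0\<^sub>m n 1 :: 'a mat)"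
      then have j: "j = 0" and i: "i < n" by auto
      have "(A' * t) $$ (i,j) = A' $$ (i,j0)"
        using i j ij carrier_matD[OF cA'] by (simp add: t_def scalar_prod_def sum_delta_mult)
      also have "\<dots> = 0" using ij i by (simp add: A')
      finally show "(A' * t) $$ (i,j) = 0\<^sub>m n 1 $$ (i,j)" using i j by simp
    qed (use cA' in auto)
    have "card {j. j < m \<and> (\<exists>i<n. A' $$ (i,j) \<noteq> 0)} < card {j. j < m \<and> (\<exists>i<n. A $$ (i,j) \<noteq> 0)}"
    proof (rule psubset_card_mono)
      show "{j. j < m \<and> (\<exists>i<n. A' $$ (i,j) \<noteq> 0)} \<subset> {j. j < m \<and> (\<exists>i<n. A $$ (i,j) \<noteq> 0)}"
      proof
        show "{j. j < m \<and> (\<exists>i<n. A' $$ (i,j) \<noteq> 0)} \<subseteq> {j. j < m \<and> (\<exists>i<n. A $$ (i,j) \<noteq> 0)}"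
        proof
          fix j assume "j \<in> {j. j < m \<and> (\<exists>i<n. A' $$ (i,j) \<noteq> 0)}"
          then obtain i where i: "j < m" "i < n" "A' $$ (i,j) \<noteq> 0" by blast
          then have "A $$ (i,j) \<noteq> 0 \<or> A $$ (i0,j) \<noteq> 0" by (auto simp: A')
          then show "j \<in> {j. j < m \<and> (\<exists>i<n. A $$ (i,j) \<noteq> 0)}" using i ij by blast
        qed
        have "j0 \<notin> {j. j < m \<and> (\<exists>i<n. A' $$ (i,j) \<noteq> 0)}" using ij by (auto simp: A')
        moreover have "j0 \<in> {j. j < m \<and> (\<exists>i<n. A $$ (i,j) \<noteq> 0)}" using ij by auto
        ultimately show "{j. j < m \<and> (\<exists>i<n. A' $$ (i,j) \<noteq> 0)} \<noteq> {j. j < m \<and> (\<exists>i<n. A $$ (i,j) \<noteq> 0)}"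
          by blast
      qed
    qed auto
    from less.hyps[OF this cA'] obtain r U V P Q where
      U: "U \<in> carrier_mat n r" and V: "V \<in> carrier_mat r m" and P: "P \<in> carrier_mat r n" and
      Q: "Q \<in> carrier_mat m r" and A'UV: "A' = U * V" and PU: "P * U = 1\<^sub>m r" and VQ: "V * Q = 1\<^sub>m r"
      by blast
    note [simp] = carrier_matD[OF U] carrier_matD[OF V] carrier_matD[OF P] carrier_matD[OF Q]
    have sU: "s * U = 0\<^sub>m 1 r"
    proof -
      have "s * U = s * A' * Q" by (simp add: A'UV mat_simps VQ)
      then show ?thesis by (simp add: sA' mat_simps)
    qed
    have Vt: "V * t = 0\<^sub>m r 1"
    proof -
      have "V * t = P * U * (V * t)" by (simp add: mat_simps PU)
      also have "\<dots> = P * (A' * t)" by (simp add: A'UV mat_simps)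
      finally show ?thesis by (simp add: A't mat_simps)
    qed
    have one: "four_block_mat (1\<^sub>m 1) (0\<^sub>m 1 r) (0\<^sub>m r 1) (1\<^sub>m r) = (1\<^sub>m (1 + r) :: 'a mat)" by simp
    have cwA': "c * w + A' = A" unfolding A'_def by (rule mat_add_minus) simp_all
    have "(c @\<^sub>c U) * (w @\<^sub>r V) = A"
      by (subst append_cols_mult_append_rows) (simp_all add: A'UV[symmetric] cwA')
    \<comment> \<open>Subtracting \<open>P * c * s\<close> makes the old left inverse kill the new
      column \<open>c\<close>; since \<open>s * U = 0\<close>, the identity \<open>P * U = 1\<close>
      survives. The next product is the mirror image.\<close>
    moreover have "(s @\<^sub>r (P - P * c * s)) * (c @\<^sub>c U) = 1\<^sub>m (1 + r)"
      by (subst append_rows_mult_append_cols) (simp_all add: mat_simps sc sU PU one)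
    moreover have "(w @\<^sub>r V) * (t @\<^sub>c (Q - t * w * Q)) = 1\<^sub>m (1 + r)"
    proof -
      have "w * (t * (w * Q)) = w * Q"
        using mat_assoc[of w t "w * Q"] by (simp add: wt mat_simps)
      moreover have "V * (t * (w * Q)) = 0\<^sub>m r r"
        using mat_assoc[of V t "w * Q"] by (simp add: Vt mat_simps)
      ultimately show ?thesis
        by (subst append_rows_mult_append_cols) (simp_all add: mat_simps wt Vt VQ one)
    qed
    ultimately show ?thesis
      by (intro exI[of _ "1 + r"] exI[of _ "c @\<^sub>c U"] exI[of _ "w @\<^sub>r V"] exI[of _ "s @\<^sub>r (P - P * c * s)"]
          exI[of _ "t @\<^sub>c (Q - t * w * Q)"] conjI carrier_matI) simp_all
  qed
qed

text \<open>With rank defined through factorizations, every exhibited factorization is an upper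
  bound, and every compression to an identity matrix is a lower bound. The link to the dimension of
  the column space is \<open>rank_eq_frank\<close>.\<close>

definition frank :: "'a::field mat \<Rightarrow> nat" where
  "frank A = (LEAST k. \<exists>U V. U \<in> carrier_mat (dim_row A) k \<and> V \<in> carrier_mat k (dim_col A) \<and> A = U * V)"

lemma frank_leI:
  assumes "dim_col U = dim_row V"
  shows "frank (U * V) \<le> dim_row V"
  unfolding frank_def using assms
  by (intro Least_le exI[of _ U] exI[of _ V] conjI carrier_matI) simp_all

lemma frank_full_factorization:
  fixes A :: "'a::field mat"
  obtains U V P Q where "U \<in> carrier_mat (dim_row A) (frank A)" "V \<in> carrier_mat (frank A) (dim_col A)"
    "P \<in> carrier_mat (frank A) (dim_row A)" "Q \<in> carrier_mat (dim_col A) (frank A)"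
    "A = U * V" "P * U = 1\<^sub>m (frank A)" "V * Q = 1\<^sub>m (frank A)"
proof -
  have "A \<in> carrier_mat (dim_row A) (dim_col A)" by auto
  from full_rank_factorization[OF this] obtain r U V P Q where
    U: "U \<in> carrier_mat (dim_row A) r" and V: "V \<in> carrier_mat r (dim_col A)" and
    P: "P \<in> carrier_mat r (dim_row A)" and Q: "Q \<in> carrier_mat (dim_col A) r" and
    UV: "A = U * V" and PU: "P * U = 1\<^sub>m r" and VQ: "V * Q = 1\<^sub>m r"
    by blast
  note d = carrier_matD[OF U] carrier_matD[OF V] carrier_matD[OF P] carrier_matD[OF Q]
  have "frank A = r"
    unfolding frank_def
  proof (rule Least_equality)
    show "\<exists>U V. U \<in> carrier_mat (dim_row A) r \<and> V \<in> carrier_mat r (dim_col A) \<and> A = U * V"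
      using U V UV by blast
  next
    fix k assume "\<exists>U V. U \<in> carrier_mat (dim_row A) k \<and> V \<in> carrier_mat k (dim_col A) \<and> A = U * V"
    then obtain U' V' where U': "U' \<in> carrier_mat (dim_row A) k" and V': "V' \<in> carrier_mat k (dim_col A)"
      and A': "A = U' * V'" by blast
    note d' = carrier_matD[OF U'] carrier_matD[OF V']
    have "1\<^sub>m r = (P * U) * (V * Q)" by (simp add: PU VQ mat_simps)
    also have "\<dots> = P * (U * V) * Q" using d by (simp add: mat_simps)
    also have "\<dots> = P * (U' * V') * Q" by (simp only: UV[symmetric] A'[symmetric])
    also have "\<dots> = (P * U') * (V' * Q)" using d d' by (simp add: mat_simps)
    finally have eq: "(P * U') * (V' * Q) = 1\<^sub>m r" by (rule sym)
    show "r \<le> k"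
      by (rule one_mat_factor_le[OF mult_carrier_mat[OF P U'] mult_carrier_mat[OF V' Q] eq])
  qed
  with U V P Q UV PU VQ that show ?thesis by blast
qed

lemma frank_one [simp]: "frank (1\<^sub>m n :: 'a::field mat) = n"
proof -
  obtain U V :: "'a mat" where "U \<in> carrier_mat n (frank (1\<^sub>m n :: 'a mat))" "V \<in> carrier_mat (frank (1\<^sub>m n :: 'a mat)) n"
    "1\<^sub>m n = U * V" using frank_full_factorization[of "1\<^sub>m n :: 'a mat"] by (metis index_one_mat(2,3))
  then have "n \<le> frank (1\<^sub>m n :: 'a mat)" by (intro one_mat_factor_le) auto
  moreover have "frank (1\<^sub>m n * 1\<^sub>m n :: 'a mat) \<le> n" using frank_leI[of "1\<^sub>m n :: 'a mat" "1\<^sub>m n"] by simp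
  ultimately show ?thesis by (simp add: mat_simps)
qed

lemma frank_mult_le1:
  fixes A B :: "'a::field mat"
  assumes "dim_col A = dim_row B"
  shows "frank (A * B) \<le> frank A"
proof -
  obtain U V where U: "U \<in> carrier_mat (dim_row A) (frank A)" and V: "V \<in> carrier_mat (frank A) (dim_col A)"
    and A: "A = U * V" using frank_full_factorization[of A] by metis
  note d = carrier_matD[OF U] carrier_matD[OF V]
  have "A * B = U * (V * B)" using assms d by (subst A) (simp add: mat_simps)
  then show ?thesis using frank_leI[of U "V * B"] d by simp
qed

lemma frank_mult_le2:
  fixes A B :: "'a::field mat"
  assumes "dim_col A = dim_row B"
  shows "frank (A * B) \<le> frank B"
proof -
  obtain U V where U: "U \<in> carrier_mat (dim_row B) (frank B)" and V: "V \<in> carrier_mat (frank B) (dim_col B)"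
    and B: "B = U * V" using frank_full_factorization[of B] by metis
  note d = carrier_matD[OF U] carrier_matD[OF V]
  have "A * B = (A * U) * V" using assms d by (subst B) (simp add: mat_simps)
  then show ?thesis using frank_leI[of "A * U" V] d by simp
qed

lemma frank_le_dim_row: "frank A \<le> dim_row A"
  using frank_leI[of "1\<^sub>m (dim_row A)" A] by (simp add: mat_simps)

lemma frank_le_dim_col: "frank A \<le> dim_col A"
  using frank_leI[of A "1\<^sub>m (dim_col A)"] by (simp add: mat_simps)

lemma frank_zero [simp]: "frank (0\<^sub>m n m :: 'a::field mat) = 0"
  using frank_leI[of "0\<^sub>m n 0" "0\<^sub>m 0 m :: 'a mat"] by (simp add: mat_simps)

lemma frank_add:
  fixes A B :: "'a::field mat"
  assumes "dim_row A = dim_row B" "dim_col A = dim_col B"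
  shows "frank (A + B) \<le> frank A + frank B"
proof -
  obtain U V where U: "U \<in> carrier_mat (dim_row A) (frank A)" and V: "V \<in> carrier_mat (frank A) (dim_col A)"
    and A: "A = U * V" using frank_full_factorization[of A] by metis
  obtain U' V' where U': "U' \<in> carrier_mat (dim_row B) (frank B)" and V': "V' \<in> carrier_mat (frank B) (dim_col B)"
    and B: "B = U' * V'" using frank_full_factorization[of B] by metis
  note d = carrier_matD[OF U] carrier_matD[OF V] carrier_matD[OF U'] carrier_matD[OF V']
  have "(U @\<^sub>c U') * (V @\<^sub>r V') = A + B"
    using assms d by (subst append_cols_mult_append_rows) (auto simp: A[symmetric] B[symmetric])
  then show ?thesis using frank_leI[of "U @\<^sub>c U'" "V @\<^sub>r V'"] d by simp
qed

lemma frank_smult_le: "frank (c \<cdot>\<^sub>m A) \<le> frank (A :: 'a::field mat)"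
proof -
  have "c \<cdot>\<^sub>m A = (c \<cdot>\<^sub>m 1\<^sub>m (dim_row A)) * A"
    by (subst mult_smult_assoc_mat[of _ _ "dim_row A" _ "dim_col A"]) (auto simp: mat_simps)
  then show ?thesis by (metis frank_mult_le2 index_smult_mat(3) index_one_mat(3))
qed

lemma frank_minus:
  fixes A B :: "'a::field mat"
  assumes "dim_row A = dim_row B" "dim_col A = dim_col B"
  shows "frank (A - B) \<le> frank A + frank B"
proof -
  have "A - B = A + (-1) \<cdot>\<^sub>m B" using assms by (intro eq_matI) auto
  then show ?thesis using frank_add[of A "(-1) \<cdot>\<^sub>m B"] frank_smult_le[of "-1" B] assms by simp
qed

lemma frank_le_minus:
  fixes A B :: "'a::field mat"
  assumes "dim_row A = dim_row B" "dim_col A = dim_col B"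
  shows "frank A \<le> frank B + frank (A - B)"
proof -
  have "B + (A - B) = A" using assms by (simp add: mat_add_minus)
  then show ?thesis using frank_add[of B "A - B"] assms by simp
qed

text \<open>For full rank factors \<open>X = U * V\<close> and \<open>Y = U' * V'\<close> the
  hypothesis becomes \<open>V * U' = 0\<close>. Stacking \<open>V\<close> on a left inverse of
  \<open>U'\<close>, and placing a right inverse of \<open>V\<close> beside \<open>U'\<close>,
  factors an identity matrix of size \<open>frank X + frank Y\<close> through dimension
  \<open>dim_row Y\<close>.\<close>

lemma sylvester:
  fixes X Y :: "'a::field mat"
  assumes "dim_col X = dim_row Y" "X * Y = 0\<^sub>m (dim_row X) (dim_col Y)"
  shows "frank X + frank Y \<le> dim_row Y"
proof -
  obtain U V P Q where U: "U \<in> carrier_mat (dim_row X) (frank X)" and V: "V \<in> carrier_mat (frank X) (dim_col X)"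
    and P: "P \<in> carrier_mat (frank X) (dim_row X)" and Q: "Q \<in> carrier_mat (dim_col X) (frank X)"
    and X: "X = U * V" and PU: "P * U = 1\<^sub>m (frank X)" and VQ: "V * Q = 1\<^sub>m (frank X)"
    using frank_full_factorization[of X] by metis
  obtain U' V' P' Q' where U': "U' \<in> carrier_mat (dim_row Y) (frank Y)" and V': "V' \<in> carrier_mat (frank Y) (dim_col Y)"
    and P': "P' \<in> carrier_mat (frank Y) (dim_row Y)" and Q': "Q' \<in> carrier_mat (dim_col Y) (frank Y)"
    and Y: "Y = U' * V'" and PU': "P' * U' = 1\<^sub>m (frank Y)" and VQ': "V' * Q' = 1\<^sub>m (frank Y)"
    using frank_full_factorization[of Y] by metis
  note d = carrier_matD[OF U] carrier_matD[OF V] carrier_matD[OF P] carrier_matD[OF Q]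
  note d' = carrier_matD[OF U'] carrier_matD[OF V'] carrier_matD[OF P'] carrier_matD[OF Q']
  have "P * X = P * U * V" using d by (subst X) (simp add: mat_assoc)
  then have PX: "P * X = V" using d by (simp add: PU mat_one_mult)
  have "Y * Q' = U' * (V' * Q')" using d' by (subst Y) (simp add: mat_assoc)
  then have YQ: "Y * Q' = U'" using d' by (simp add: VQ' mat_mult_one)
  have "V * U' = P * (X * Y) * Q'" using d d' assms(1) by (simp add: mat_assoc PX[symmetric] YQ[symmetric])
  also have "\<dots> = 0\<^sub>m (frank X) (frank Y)" using d d' assms by (simp add: mat_zero_mult mat_mult_zero)
  finally have VU': "V * U' = 0\<^sub>m (frank X) (frank Y)" .
  \<comment> \<open>The correction \<open>P' * Q * V\<close> makes the lower rows kill
    \<open>Q\<close>; because \<open>V * U' = 0\<close> it leaves \<open>P' * U' = 1\<close>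
    intact.\<close>
  have "(V @\<^sub>r (P' - P' * Q * V)) * (Q @\<^sub>c U') = four_block_mat (1\<^sub>m (frank X)) (0\<^sub>m (frank X) (frank Y)) (0\<^sub>m (frank Y) (frank X)) (1\<^sub>m (frank Y))"
    using d d' assms(1)
    by (subst append_rows_mult_append_cols) (simp_all add: mat_simps VQ VU' PU')
  then show ?thesis
    using d d' assms(1) by (intro one_mat_factor_le[of "V @\<^sub>r (P' - P' * Q * V)" _ _ "Q @\<^sub>c U'"] carrier_matI) simp_all
qed

text \<open>This is the Frobenius rank inequality for a vanishing triple product. Writing
  \<open>B = U * V\<close> with inner dimension \<open>frank B\<close> reduces it to Sylvester's
  inequality for \<open>A * U\<close> and \<open>V * C\<close>. It is the device that adds up the
  ranks of two compressions of one matrix.\<close>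

lemma frobenius:
  fixes A B C :: "'a::field mat"
  assumes "dim_col A = dim_row B" "dim_col B = dim_row C" "A * B * C = 0\<^sub>m (dim_row A) (dim_col C)"
  shows "frank (A * B) + frank (B * C) \<le> frank B"
proof -
  obtain U V where U: "U \<in> carrier_mat (dim_row B) (frank B)" and V: "V \<in> carrier_mat (frank B) (dim_col B)"
    and B: "B = U * V" using frank_full_factorization[of B] by metis
  note d = carrier_matD[OF U] carrier_matD[OF V]
  have "A * B = (A * U) * V" using d assms by (subst B) (simp add: mat_simps)
  then have 1: "frank (A * B) \<le> frank (A * U)" using d frank_mult_le1[of "A * U" V] by simp
  have BC: "B * C = U * (V * C)" using d assms by (subst B) (simp add: mat_simps)
  then have 2: "frank (B * C) \<le> frank (V * C)" using d assms frank_mult_le2[of U "V * C"] by simp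
  have "(A * U) * (V * C) = A * (B * C)" using d assms by (simp add: BC mat_simps)
  also have "\<dots> = 0\<^sub>m (dim_row A) (dim_col C)" using assms by (simp add: mat_simps)
  finally have "frank (A * U) + frank (V * C) \<le> dim_row (V * C)"
    using d assms by (intro sylvester) auto
  with 1 2 d show ?thesis by simp
qed

text \<open>\<open>U * P\<close> projects onto the column space of \<open>X\<close>, and
  \<open>Q\<close> is the complementary projection. Any \<open>Z\<close> is \<open>Q * Z\<close>
  plus a matrix that factors through \<open>frank X\<close> dimensions, which bounds the loss of
  rank.\<close>

lemma left_annihilator:
  fixes X :: "'a::field mat"
  obtains Q where "Q \<in> carrier_mat (dim_row X) (dim_row X)" "Q * X = 0\<^sub>m (dim_row X) (dim_col X)"
    "\<And>Z. dim_row Z = dim_row X \<Longrightarrow> frank Z \<le> frank (Q * Z) + frank X"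
proof -
  obtain U V P Q where U: "U \<in> carrier_mat (dim_row X) (frank X)" and V: "V \<in> carrier_mat (frank X) (dim_col X)"
    and P: "P \<in> carrier_mat (frank X) (dim_row X)"
    and X: "X = U * V" and PU: "P * U = 1\<^sub>m (frank X)"
    using frank_full_factorization[of X] by metis
  note d = carrier_matD[OF U] carrier_matD[OF V] carrier_matD[OF P]
  let ?Q = "1\<^sub>m (dim_row X) - U * P"
  show thesis
  proof (rule that)
    show "?Q \<in> carrier_mat (dim_row X) (dim_row X)" using d by (intro carrier_matI) simp_all
    have "P * X = V" using d mat_assoc[of P U V] by (simp add: X[symmetric] PU mat_simps)
    then have "U * P * X = X" using d by (simp add: mat_simps X[symmetric])
    then show "?Q * X = 0\<^sub>m (dim_row X) (dim_col X)"
      using d by (simp add: mat_minus_mult mat_one_mult mat_minus_self)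
    fix Z :: "'a mat" assume Z: "dim_row Z = dim_row X"
    have "frank (U * (P * Z)) \<le> frank X" using frank_leI[of U "P * Z"] d by simp
    moreover have "frank (U * (P * Z) + ?Q * Z) \<le> frank (U * (P * Z)) + frank (?Q * Z)"
      using d Z by (intro frank_add) auto
    moreover have "U * (P * Z) + ?Q * Z = Z"
      using d Z by (simp add: mat_minus_mult mat_one_mult mat_assoc mat_add_minus)
    ultimately show "frank Z \<le> frank (?Q * Z) + frank X" by simp
  qed
qed

lemma right_annihilator:
  fixes X :: "'a::field mat"
  obtains L where "L \<in> carrier_mat (dim_col X) (dim_col X)" "X * L = 0\<^sub>m (dim_row X) (dim_col X)"
    "\<And>Z. dim_col Z = dim_col X \<Longrightarrow> frank Z \<le> frank (Z * L) + frank X"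
proof -
  obtain U V Q where U: "U \<in> carrier_mat (dim_row X) (frank X)" and V: "V \<in> carrier_mat (frank X) (dim_col X)"
    and Q: "Q \<in> carrier_mat (dim_col X) (frank X)"
    and X: "X = U * V" and VQ: "V * Q = 1\<^sub>m (frank X)"
    using frank_full_factorization[of X] by metis
  note d = carrier_matD[OF U] carrier_matD[OF V] carrier_matD[OF Q]
  let ?L = "1\<^sub>m (dim_col X) - Q * V"
  show thesis
  proof (rule that)
    show "?L \<in> carrier_mat (dim_col X) (dim_col X)" using d by (intro carrier_matI) simp_all
    have "X * Q = U" using d by (subst X) (simp add: VQ mat_simps)
    then have "X * (Q * V) = X" using d mat_assoc[of X Q V] by (simp add: X[symmetric])
    then show "X * ?L = 0\<^sub>m (dim_row X) (dim_col X)"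
      using d by (simp add: mat_mult_minus mat_mult_one mat_minus_self)
    fix Z :: "'a mat" assume Z: "dim_col Z = dim_col X"
    have "frank ((Z * Q) * V) \<le> frank X" using frank_leI[of "Z * Q" V] d by simp
    moreover have "frank ((Z * Q) * V + Z * ?L) \<le> frank ((Z * Q) * V) + frank (Z * ?L)"
      using d Z by (intro frank_add) auto
    moreover have "(Z * Q) * V + Z * ?L = Z"
      using d Z by (simp add: mat_mult_minus mat_mult_one mat_assoc mat_add_minus)
    ultimately show "frank Z \<le> frank (Z * ?L) + frank X" by simp
  qed
qed

section \<open>Kronecker products\<close>

definition kron :: "'a::semiring_0 mat \<Rightarrow> 'a mat \<Rightarrow> 'a mat" where
  "kron A B = mat (dim_row A * dim_row B) (dim_col A * dim_col B)
     (\<lambda>(i,j). A $$ (i div dim_row B, j div dim_col B) * B $$ (i mod dim_row B, j mod dim_col B))"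

lemma dim_kron [simp]:
  "dim_row (kron A B) = dim_row A * dim_row B" "dim_col (kron A B) = dim_col A * dim_col B"
  by (simp_all add: kron_def)

lemma index_kron:
  assumes "i < dim_row A * dim_row B" "j < dim_col A * dim_col B"
  shows "kron A B $$ (i,j) =
    A $$ (i div dim_row B, j div dim_col B) * B $$ (i mod dim_row B, j mod dim_col B)"
  using assms by (simp add: kron_def)

lemma div_mod_less_times:
  assumes "i < p * (q::nat)"
  shows "i div q < p" "i mod q < q"
proof -
  have "0 < q" using assms by (cases q) auto
  then show "i mod q < q" by simp
  show "i div q < p" using assms by (simp add: less_mult_imp_div_less)
qed

lemma sum_div_mod:
  fixes f :: "nat \<Rightarrow> nat \<Rightarrow> 'a::comm_monoid_add"
  shows "(\<Sum>l = 0..<p * q. f (l div q) (l mod q)) = (\<Sum>a = 0..<p. \<Sum>b = 0..<q. f a b)"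
proof -
  have "(\<Sum>l = 0..<p * q. f (l div q) (l mod q)) = (\<Sum>(a,b)\<in>{0..<p} \<times> {0..<q}. f a b)"
  proof (rule sum.reindex_bij_witness[of _ "\<lambda>(a,b). a * q + b" "\<lambda>l. (l div q, l mod q)"])
    fix x assume "x \<in> {0..<p} \<times> {0..<q}"
    then obtain a b where x: "x = (a,b)" "a < p" "b < q" by auto
    have "Suc a * q \<le> p * q" using x by (intro mult_le_mono1) auto
    then show "(case x of (a,b) \<Rightarrow> a * q + b) \<in> {0..<p * q}" using x by auto
  qed (auto simp: div_mod_less_times)
  then show ?thesis by (simp add: sum.cartesian_product)
qed

lemma kron_mult:
  fixes A B C D :: "'a::comm_semiring_0 mat"
  assumes d: "dim_col A = dim_row C" "dim_col B = dim_row D"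
  shows "kron A B * kron C D = kron (A * C) (B * D)"
proof (rule eq_matI)
  fix i j assume "i < dim_row (kron (A * C) (B * D))" "j < dim_col (kron (A * C) (B * D))"
  then have i: "i < dim_row A * dim_row B" and j: "j < dim_col C * dim_col D" by auto
  let ?i = "i div dim_row B" and ?i' = "i mod dim_row B"
  let ?j = "j div dim_col D" and ?j' = "j mod dim_col D"
  note b = div_mod_less_times[OF i] div_mod_less_times[OF j]
  have "(kron A B * kron C D) $$ (i,j) =
    (\<Sum>l = 0..<dim_row C * dim_row D. kron A B $$ (i,l) * kron C D $$ (l,j))"
    using i j by (simp add: scalar_prod_def d)
  also have "\<dots> = (\<Sum>l = 0..<dim_row C * dim_row D.
    (A $$ (?i, l div dim_row D) * B $$ (?i', l mod dim_row D)) *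
    (C $$ (l div dim_row D, ?j) * D $$ (l mod dim_row D, ?j')))"
    using i j d by (intro sum.cong refl) (simp add: index_kron)
  also have "\<dots> = (\<Sum>a = 0..<dim_row C. \<Sum>b = 0..<dim_row D.
    (A $$ (?i, a) * B $$ (?i', b)) * (C $$ (a, ?j) * D $$ (b, ?j')))"
    by (rule sum_div_mod)
  also have "\<dots> = (\<Sum>a = 0..<dim_row C. A $$ (?i, a) * C $$ (a, ?j)) *
      (\<Sum>b = 0..<dim_row D. B $$ (?i', b) * D $$ (b, ?j'))"
    unfolding sum_product by (intro sum.cong refl) (simp add: ac_simps)
  also have "\<dots> = kron (A * C) (B * D) $$ (i,j)"
    using i j b d by (simp add: index_kron scalar_prod_def)
  finally show "(kron A B * kron C D) $$ (i,j) = kron (A * C) (B * D) $$ (i,j)" .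
qed simp_all

lemma kron_one: "kron (1\<^sub>m n) (1\<^sub>m m) = (1\<^sub>m (n * m) :: 'a::semiring_1 mat)"
proof (rule eq_matI)
  fix i j assume "i < dim_row (1\<^sub>m (n * m) :: 'a mat)" "j < dim_col (1\<^sub>m (n * m) :: 'a mat)"
  then have i: "i < n * m" and j: "j < n * m" by auto
  have "i = j \<longleftrightarrow> i div m = j div m \<and> i mod m = j mod m" by (metis div_mult_mod_eq)
  then show "kron (1\<^sub>m n) (1\<^sub>m m) $$ (i,j) = (1\<^sub>m (n * m) :: 'a mat) $$ (i,j)"
    using i j div_mod_less_times[OF i] div_mod_less_times[OF j] by (auto simp: index_kron)
qed simp_all

lemma kron_minus_left:
  fixes A B C :: "'a::ring mat"
  assumes "dim_row A = dim_row B" "dim_col A = dim_col B"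
  shows "kron (A - B) C = kron A C - kron B C"
proof (rule eq_matI)
  fix i j assume "i < dim_row (kron A C - kron B C)" "j < dim_col (kron A C - kron B C)"
  then have i: "i < dim_row B * dim_row C" and j: "j < dim_col B * dim_col C" by auto
  show "kron (A - B) C $$ (i,j) = (kron A C - kron B C) $$ (i,j)"
    using i j div_mod_less_times[OF i] div_mod_less_times[OF j] assms
    by (simp add: index_kron left_diff_distrib)
qed (simp_all add: assms)

lemma kron_minus_right:
  fixes A B C :: "'a::ring mat"
  assumes "dim_row A = dim_row B" "dim_col A = dim_col B"
  shows "kron C (A - B) = kron C A - kron C B"
proof (rule eq_matI)
  fix i j assume "i < dim_row (kron C A - kron C B)" "j < dim_col (kron C A - kron C B)"
  then have i: "i < dim_row C * dim_row B" and j: "j < dim_col C * dim_col B" by auto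
  show "kron C (A - B) $$ (i,j) = (kron C A - kron C B) $$ (i,j)"
    using i j div_mod_less_times[OF i] div_mod_less_times[OF j] assms
    by (simp add: index_kron right_diff_distrib)
qed (simp_all add: assms)

lemma kron_zero_right: "kron B (0\<^sub>m n m) = 0\<^sub>m (dim_row B * n) (dim_col (B :: 'a::semiring_0 mat) * m)"
  by (rule eq_matI) (auto simp: index_kron div_mod_less_times)

lemma kron_scalar:
  assumes "dim_row M = 1" "dim_col M = 1"
  shows "kron A M = M $$ (0,0) \<cdot>\<^sub>m (A :: 'a::comm_semiring_0 mat)"
  using assms by (intro eq_matI) (auto simp: index_kron mult.commute)

text \<open>The one-sided inverses of the factors can be tensored: \<open>P * A * Q\<close> and
  \<open>P' * B * Q'\<close> are identity matrices, so \<open>kron A B\<close> compresses to an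
  identity matrix of size \<open>frank A * frank B\<close>.\<close>

lemma frank_kron_ge: "frank A * frank B \<le> frank (kron A (B :: 'a::field mat))"
proof -
  obtain U V P Q where U: "U \<in> carrier_mat (dim_row A) (frank A)" and V: "V \<in> carrier_mat (frank A) (dim_col A)"
    and P: "P \<in> carrier_mat (frank A) (dim_row A)" and Q: "Q \<in> carrier_mat (dim_col A) (frank A)"
    and A: "A = U * V" and PU: "P * U = 1\<^sub>m (frank A)" and VQ: "V * Q = 1\<^sub>m (frank A)"
    using frank_full_factorization[of A] by metis
  obtain U' V' P' Q' where U': "U' \<in> carrier_mat (dim_row B) (frank B)" and V': "V' \<in> carrier_mat (frank B) (dim_col B)"
    and P': "P' \<in> carrier_mat (frank B) (dim_row B)" and Q': "Q' \<in> carrier_mat (dim_col B) (frank B)"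
    and B: "B = U' * V'" and PU': "P' * U' = 1\<^sub>m (frank B)" and VQ': "V' * Q' = 1\<^sub>m (frank B)"
    using frank_full_factorization[of B] by metis
  note d = carrier_matD[OF U] carrier_matD[OF V] carrier_matD[OF P] carrier_matD[OF Q]
  note d' = carrier_matD[OF U'] carrier_matD[OF V'] carrier_matD[OF P'] carrier_matD[OF Q']
  have "P * A = P * U * V" using d by (subst A) (simp add: mat_assoc)
  then have 1: "P * A * Q = 1\<^sub>m (frank A)" using d by (simp add: PU mat_one_mult VQ)
  have "P' * B = P' * U' * V'" using d' by (subst B) (simp add: mat_assoc)
  then have 2: "P' * B * Q' = 1\<^sub>m (frank B)" using d' by (simp add: PU' mat_one_mult VQ')
  have "kron P P' * kron A B * kron Q Q' = 1\<^sub>m (frank A * frank B)"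
    using d d' by (simp add: kron_mult 1 2 kron_one)
  then have "frank A * frank B = frank (kron P P' * kron A B * kron Q Q')" by simp
  also have "\<dots> \<le> frank (kron P P' * kron A B)" using d d' by (intro frank_mult_le1) simp
  also have "\<dots> \<le> frank (kron A B)" using d d' by (intro frank_mult_le2) simp
  finally show ?thesis .
qed

lemma frank_kron_le_left: "frank (kron A B) \<le> frank A * dim_row (B :: 'a::field mat)"
proof -
  obtain U V where U: "U \<in> carrier_mat (dim_row A) (frank A)" and V: "V \<in> carrier_mat (frank A) (dim_col A)"
    and A: "A = U * V" using frank_full_factorization[of A] by metis
  note d = carrier_matD[OF U] carrier_matD[OF V]
  have "kron U (1\<^sub>m (dim_row B)) * kron V B = kron A B"
    using d by (simp add: kron_mult mat_one_mult A[symmetric])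
  then show ?thesis using frank_leI[of "kron U (1\<^sub>m (dim_row B))" "kron V B"] d by simp
qed

lemma frank_kron_le_right: "frank (kron A B) \<le> dim_col A * frank (B :: 'a::field mat)"
proof -
  obtain U V where U: "U \<in> carrier_mat (dim_row B) (frank B)" and V: "V \<in> carrier_mat (frank B) (dim_col B)"
    and B: "B = U * V" using frank_full_factorization[of B] by metis
  note d = carrier_matD[OF U] carrier_matD[OF V]
  have "kron A U * kron (1\<^sub>m (dim_col A)) V = kron A B"
    using d by (simp add: kron_mult mat_mult_one B[symmetric])
  then show ?thesis using frank_leI[of "kron A U" "kron (1\<^sub>m (dim_col A)) V"] d by simp
qed

text \<open>Let \<open>Q\<close> annihilate \<open>X - X'\<close> from the left and \<open>L\<close>
  annihilate \<open>Y - Y'\<close> from the right. Then \<open>Q \<otimes> 1\<close> turns the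
  difference into \<open>Q X \<otimes> (Y - Y')\<close>, while \<open>1 \<otimes> L\<close> turns it
  into \<open>(X - X') \<otimes> Y L\<close>. Applying both gives zero, so the Frobenius inequality
  adds the two ranks. This sum is the source of the growth under tensor squares.\<close>

lemma frank_kron_diff:
  fixes X X' Y Y' :: "'a::field mat"
  assumes "X \<in> carrier_mat n n" "X' \<in> carrier_mat n n" "Y \<in> carrier_mat m m" "Y' \<in> carrier_mat m m"
  defines "r \<equiv> frank (X - X')" and "s \<equiv> frank (Y - Y')"
  shows "(frank X - r) * s + r * (frank Y - s) \<le> frank (kron X Y - kron X' Y')"
proof -
  note d = carrier_matD[OF assms(1)] carrier_matD[OF assms(2)] carrier_matD[OF assms(3)] carrier_matD[OF assms(4)]
  obtain Q where Q: "Q \<in> carrier_mat n n" and QX: "Q * (X - X') = 0\<^sub>m n n"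
    and rQ: "\<And>Z. dim_row Z = n \<Longrightarrow> frank Z \<le> frank (Q * Z) + r"
    using left_annihilator[of "X - X'"] d by (auto simp: r_def)
  obtain L where L: "L \<in> carrier_mat m m" and YL: "(Y - Y') * L = 0\<^sub>m m m"
    and rL: "\<And>Z. dim_col Z = m \<Longrightarrow> frank Z \<le> frank (Z * L) + s"
    using right_annihilator[of "Y - Y'"] d by (auto simp: s_def)
  note d = d carrier_matD[OF Q] carrier_matD[OF L]
  have eq0: "A = B" if "A - B = 0\<^sub>m k l" "dim_row A = k" "dim_row B = k" "dim_col A = l" "dim_col B = l"
    for A B :: "'a mat" and k l
  proof -
    have "B + (A - B) = A" using that by (intro mat_add_minus) auto
    moreover have "B + 0\<^sub>m k l = B" using that by (intro eq_matI) auto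
    ultimately show ?thesis using that by simp
  qed
  have QX': "Q * X = Q * X'" by (rule eq0[of _ _ n n]) (use QX d in \<open>simp_all add: mat_mult_minus\<close>)
  have YL': "Y * L = Y' * L" by (rule eq0[of _ _ m m]) (use YL d in \<open>simp_all add: mat_minus_mult\<close>)
  let ?B = "kron X Y - kron X' Y'"
  let ?A = "kron Q (1\<^sub>m m)" and ?C = "kron (1\<^sub>m n) L"
  have AB: "?A * ?B = kron (Q * X) (Y - Y')"
    using d by (simp add: mat_mult_minus kron_mult mat_one_mult kron_minus_right QX')
  have BC: "?B * ?C = kron (X - X') (Y * L)"
    using d by (simp add: mat_minus_mult kron_mult mat_mult_one kron_minus_left YL')
  have "?A * ?B * ?C = 0\<^sub>m (n * m) (n * m)"
    using d by (simp add: AB kron_mult YL kron_zero_right)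
  then have "frank (?A * ?B) + frank (?B * ?C) \<le> frank ?B"
    using d by (intro frobenius) simp_all
  moreover have "frank (Q * X) * s \<le> frank (?A * ?B)"
    unfolding AB s_def by (rule frank_kron_ge)
  moreover have "r * frank (Y * L) \<le> frank (?B * ?C)"
    unfolding BC r_def by (rule frank_kron_ge)
  moreover have "(frank X - r) * s \<le> frank (Q * X) * s"
    using rQ[of X] d by (intro mult_le_mono1) simp
  moreover have "r * (frank Y - s) \<le> r * frank (Y * L)"
    using rL[of Y] d by (intro mult_le_mono2) simp
  ultimately show ?thesis by linarith
qed

section \<open>Ranks of sums of Kronecker products\<close>

text \<open>The sizes are arguments because the zero matrix, and with it the empty sum, depends on
  them.\<close>

definition msum :: "nat \<Rightarrow> nat \<Rightarrow> ('i \<Rightarrow> 'a::comm_monoid_add mat) \<Rightarrow> 'i set \<Rightarrow> 'a mat" where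
  "msum n m f S = mat n m (\<lambda>ij. \<Sum>s\<in>S. f s $$ ij)"

lemma dim_msum [simp]: "dim_row (msum n m f S) = n" "dim_col (msum n m f S) = m"
  by (simp_all add: msum_def)

lemma index_msum: "i < n \<Longrightarrow> j < m \<Longrightarrow> msum n m f S $$ (i,j) = (\<Sum>s\<in>S. f s $$ (i,j))"
  by (simp add: msum_def)

lemma msum_cong: "S = T \<Longrightarrow> (\<And>s. s \<in> T \<Longrightarrow> f s = g s) \<Longrightarrow> msum n m f S = msum n m g T"
  by (simp add: msum_def)

lemma mult_msum:
  fixes A :: "'a::comm_semiring_0 mat"
  assumes "dim_col A = n" "\<And>s. s \<in> S \<Longrightarrow> f s \<in> carrier_mat n m"
  shows "A * msum n m f S = msum (dim_row A) m (\<lambda>s. A * f s) S"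
proof (rule eq_matI)
  fix i j assume "i < dim_row (msum (dim_row A) m (\<lambda>s. A * f s) S)" "j < dim_col (msum (dim_row A) m (\<lambda>s. A * f s) S)"
  then have i: "i < dim_row A" and j: "j < m" by auto
  have "(A * msum n m f S) $$ (i,j) = (\<Sum>l = 0..<n. \<Sum>s\<in>S. A $$ (i,l) * f s $$ (l,j))"
    using i j assms by (simp add: scalar_prod_def index_msum sum_distrib_left)
  also have "\<dots> = (\<Sum>s\<in>S. \<Sum>l = 0..<n. A $$ (i,l) * f s $$ (l,j))" by (rule sum.swap)
  also have "\<dots> = msum (dim_row A) m (\<lambda>s. A * f s) S $$ (i,j)"
    using i j assms(1) carrier_matD[OF assms(2)] by (simp add: index_msum scalar_prod_def)
  finally show "(A * msum n m f S) $$ (i,j) = msum (dim_row A) m (\<lambda>s. A * f s) S $$ (i,j)" .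
qed simp_all

lemma msum_mult:
  fixes A :: "'a::comm_semiring_0 mat"
  assumes "dim_row A = m" "\<And>s. s \<in> S \<Longrightarrow> f s \<in> carrier_mat n m"
  shows "msum n m f S * A = msum n (dim_col A) (\<lambda>s. f s * A) S"
proof (rule eq_matI)
  fix i j assume "i < dim_row (msum n (dim_col A) (\<lambda>s. f s * A) S)" "j < dim_col (msum n (dim_col A) (\<lambda>s. f s * A) S)"
  then have i: "i < n" and j: "j < dim_col A" by auto
  have "(msum n m f S * A) $$ (i,j) = (\<Sum>l = 0..<m. \<Sum>s\<in>S. f s $$ (i,l) * A $$ (l,j))"
    using i j assms by (simp add: scalar_prod_def index_msum sum_distrib_right)
  also have "\<dots> = (\<Sum>s\<in>S. \<Sum>l = 0..<m. f s $$ (i,l) * A $$ (l,j))" by (rule sum.swap)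
  also have "\<dots> = msum n (dim_col A) (\<lambda>s. f s * A) S $$ (i,j)"
    using i j assms(1) carrier_matD[OF assms(2)] by (simp add: index_msum scalar_prod_def)
  finally show "(msum n m f S * A) $$ (i,j) = msum n (dim_col A) (\<lambda>s. f s * A) S $$ (i,j)" .
qed simp_all

lemma exists_nonzero_entry:
  fixes A :: "'a::field mat"
  assumes "0 < frank A"
  obtains i j where "i < dim_row A" "j < dim_col A" "A $$ (i,j) \<noteq> 0"
proof -
  have "\<exists>i<dim_row A. \<exists>j<dim_col A. A $$ (i,j) \<noteq> 0"
  proof (rule ccontr)
    assume "\<not> ?thesis"
    then have "A = 0\<^sub>m (dim_row A) (dim_col A)" by (intro eq_matI) auto
    then have "frank A = 0" by (metis frank_zero)
    with assms show False by simp
  qed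
  with that show thesis by blast
qed

text \<open>One column \<open>v\<close> with \<open>Z g v \<noteq> 0\<close> is peeled off at a time: it contributes \<open>\<rho>\<close> to the rank,
  and annihilating all the vectors \<open>Z i v\<close> costs \<open>Z g\<close> at most \<open>card S\<close> of its rank.\<close>

lemma frank_tensor_sum_aux:
  fixes Y Z :: "'i \<Rightarrow> 'a::field mat" and \<rho> :: real
  assumes S: "finite S" "g \<in> S"
    and Y: "\<And>i. i \<in> S \<Longrightarrow> Y i \<in> carrier_mat n n"
    and \<rho>: "\<And>x. x g \<noteq> 0 \<Longrightarrow> \<rho> \<le> frank (msum n n (\<lambda>i. x i \<cdot>\<^sub>m Y i) S)"
    and Z: "\<And>i. i \<in> S \<Longrightarrow> Z i \<in> carrier_mat m m'"
    and k: "k * card S < frank (Z g) + card S"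
  shows "\<rho> * k \<le> frank (msum (n * m) (n * m') (\<lambda>i. kron (Y i) (Z i)) S)"
  using Z k
proof (induction k arbitrary: Z)
  case 0
  then show ?case by simp
next
  case (Suc k)
  note dY = carrier_matD[OF Y] and dZ = carrier_matD[OF Suc.prems(1)]
  have "0 < frank (Z g)" using Suc.prems(2) by simp
  then obtain i0 j0 where ij: "i0 < m" "j0 < m'" "Z g $$ (i0,j0) \<noteq> 0"
    using exists_nonzero_entry[of "Z g"] dZ[OF S(2)] by metis
  \<comment> \<open>\<open>v\<close> and \<open>u\<close> single out the column and the row of a
    nonzero entry of \<open>Z g\<close>, so \<open>u * (Z g * v)\<close> is a nonzero
    scalar.\<close>
  define v where "v = mat m' 1 (\<lambda>(i,j). if i = j0 then 1 else (0::'a))"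
  define u where "u = mat 1 m (\<lambda>(i,j). if j = i0 then 1 else (0::'a))"
  have dv: "dim_row v = m'" "dim_col v = 1" "dim_row u = 1" "dim_col u = m" by (simp_all add: v_def u_def)
  have Zv: "(Z i * v) $$ (a,0) = Z i $$ (a,j0)" if "i \<in> S" "a < m" for i a
    using that ij dZ by (simp add: v_def scalar_prod_def sum_delta_mult)
  have uZv: "(u * (Z i * v)) $$ (0,0) = Z i $$ (i0,j0)" if "i \<in> S" for i
  proof -
    have "(u * (Z i * v)) $$ (0,0) = (\<Sum>l = 0..<m. (if l = i0 then 1 else 0) * (Z i * v) $$ (l,0))"
      using that dZ dv by (simp add: u_def scalar_prod_def del: index_mult_mat(1)) (simp add: scalar_prod_def)
    also have "\<dots> = Z i $$ (i0,j0)" using ij Zv[OF that] by (simp add: sum_delta_mult)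
    finally show ?thesis .
  qed
  obtain ss where ss: "set ss = S" "distinct ss" using finite_distinct_list[OF S(1)] by blast
  \<comment> \<open>The columns of \<open>W\<close> are the vectors \<open>Z i * v\<close>.
    Annihilating them all by one \<open>Q\<close> costs at most the number of columns, which is the
    \<open>card S\<close> allowed by the hypothesis on \<open>k\<close>.\<close>
  define W where "W = mat m (card S) (\<lambda>(a,b). Z (ss ! b) $$ (a,j0))"
  have dW: "dim_row W = m" "dim_col W = card S" by (simp_all add: W_def)
  have lss: "length ss = card S" using ss distinct_card by metis
  obtain Q where Q: "Q \<in> carrier_mat m m" and QW: "Q * W = 0\<^sub>m m (card S)"
    and rQ: "\<And>A. dim_row A = m \<Longrightarrow> frank A \<le> frank (Q * A) + frank W"
    using left_annihilator[of W] dW by metis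
  note dQ = carrier_matD[OF Q]
  have QZv: "Q * (Z i * v) = 0\<^sub>m m 1" if i: "i \<in> S" for i
  proof -
    obtain b where b: "b < card S" "ss ! b = i" using i ss lss by (metis in_set_conv_nth)
    have "Z i * v = W * mat (card S) 1 (\<lambda>(l,j). if l = b then 1 else 0)"
    proof (rule eq_matI)
      fix a j assume "a < dim_row (W * mat (card S) 1 (\<lambda>(l,j). if l = b then 1 else 0))"
        "j < dim_col (W * mat (card S) 1 (\<lambda>(l,j). if l = b then 1 else (0::'a)))"
      then have a: "a < m" "j = 0" using dW by auto
      have "(W * mat (card S) 1 (\<lambda>(l,j). if l = b then 1 else 0)) $$ (a,0) = W $$ (a,b)"
        using a dW b by (simp add: scalar_prod_def sum_delta_mult)
      also have "\<dots> = Z i $$ (a,j0)" using a b by (simp add: W_def)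
      finally show "(Z i * v) $$ (a,j) = (W * mat (card S) 1 (\<lambda>(l,j). if l = b then 1 else 0)) $$ (a,j)"
        using a Zv[OF i] by simp
    qed (use dW dZ[OF i] dv in auto)
    then have "Q * (Z i * v) = (Q * W) * mat (card S) 1 (\<lambda>(l,j). if l = b then 1 else 0)"
      using dQ dW by (simp add: mat_assoc)
    then show ?thesis by (simp add: QW mat_zero_mult)
  qed
  let ?B = "msum (n * m) (n * m') (\<lambda>i. kron (Y i) (Z i)) S"
  let ?A = "kron (1\<^sub>m n) Q" and ?C = "kron (1\<^sub>m n) v"
  have cB: "kron (Y i) (Z i) \<in> carrier_mat (n * m) (n * m')" if "i \<in> S" for i
    using dY[OF that] dZ[OF that] by (intro carrier_matI) simp_all
  have AB: "?A * ?B = msum (n * m) (n * m') (\<lambda>i. kron (Y i) (Q * Z i)) S"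
    using dQ dY dZ cB by (subst mult_msum) (auto intro!: msum_cong simp: kron_mult mat_one_mult)
  have BC: "?B * ?C = msum (n * m) (n * 1) (\<lambda>i. kron (Y i) (Z i * v)) S"
    using dv dY dZ cB by (subst msum_mult) (auto intro!: msum_cong simp: kron_mult mat_mult_one)
  have cBC: "kron (Y i) (Z i * v) \<in> carrier_mat (n * m) (n * 1)" if "i \<in> S" for i
    using dY[OF that] dZ[OF that] dv by (intro carrier_matI) simp_all
  have "?A * (?B * ?C) = msum (n * m) (n * 1) (\<lambda>i. 0\<^sub>m (n * m) n) S"
    unfolding BC using dQ dv dY dZ cBC
    by (subst mult_msum) (auto intro!: msum_cong simp: kron_mult mat_one_mult QZv kron_zero_right)
  also have "\<dots> = 0\<^sub>m (n * m) n" by (rule eq_matI) (simp_all add: index_msum)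
  finally have "?A * ?B * ?C = 0\<^sub>m (n * m) n" using dQ dv by (simp add: mat_assoc)
  then have "frank (?A * ?B) + frank (?B * ?C) \<le> frank ?B"
    using dQ dv by (intro frobenius) simp_all
  moreover have "\<rho> * k \<le> frank (?A * ?B)"
    unfolding AB
  proof (rule Suc.IH)
    show "Q * Z i \<in> carrier_mat m m'" if "i \<in> S" for i
      using dQ dZ[OF that] by (intro carrier_matI) simp_all
    have "frank W \<le> card S" using frank_le_dim_col[of W] dW by simp
    then show "k * card S < frank (Q * Z g) + card S"
      using rQ[of "Z g"] dZ[OF S(2)] Suc.prems(2) by simp
  qed
  moreover have "\<rho> \<le> frank (?B * ?C)"
  proof -
    \<comment> \<open>Compression by \<open>u\<close> makes every second factor a scalar. What
      remains is a combination of the \<open>Y i\<close> with nonzero coefficient at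
      \<open>g\<close>, so the hypothesis on \<open>\<rho>\<close> applies.\<close>
    have "kron (1\<^sub>m n) u * (?B * ?C) = msum n n (\<lambda>i. (Z i $$ (i0,j0)) \<cdot>\<^sub>m Y i) S"
      unfolding BC using dv dY dZ cBC
      by (subst mult_msum) (auto intro!: msum_cong simp: kron_mult mat_one_mult kron_scalar uZv simp del: index_mult_mat(1))
    then have "frank (msum n n (\<lambda>i. (Z i $$ (i0,j0)) \<cdot>\<^sub>m Y i) S) \<le> frank (?B * ?C)"
      using frank_mult_le2[of "kron (1\<^sub>m n) u" "?B * ?C"] dv by simp
    with \<rho>[of "\<lambda>i. Z i $$ (i0,j0)"] ij show ?thesis by simp
  qed
  ultimately have "\<rho> * k + \<rho> \<le> frank ?B" by linarith
  then show ?case by (simp add: algebra_simps)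
qed

text \<open>The number of vectors that can be peeled off is the ceiling of
  \<open>frank (Z g) / card S\<close>, which is \<open>?k\<close>. Rounding up is what gives
  \<open>frank (Z g) \<le> ?k * ?s\<close> and hence a clean linear bound.\<close>

lemma frank_tensor_sum:
  fixes Y Z :: "'i \<Rightarrow> 'a::field mat" and \<rho> :: real
  assumes S: "finite S" "g \<in> S"
    and Y: "\<And>i. i \<in> S \<Longrightarrow> Y i \<in> carrier_mat n n"
    and \<rho>: "0 \<le> \<rho>" "\<And>x. x g \<noteq> 0 \<Longrightarrow> \<rho> \<le> frank (msum n n (\<lambda>i. x i \<cdot>\<^sub>m Y i) S)"
    and Z: "\<And>i. i \<in> S \<Longrightarrow> Z i \<in> carrier_mat m m'"
  shows "\<rho> * frank (Z g) \<le> card S * frank (msum (n * m) (n * m') (\<lambda>i. kron (Y i) (Z i)) S)"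
proof -
  let ?s = "card S" let ?k = "(frank (Z g) + ?s - 1) div ?s"
  have s: "0 < ?s" using S by (auto simp: card_gt_0_iff)
  have ks: "?k * ?s \<le> frank (Z g) + ?s - 1" by (rule div_times_less_eq_dividend)
  have "?k * ?s < frank (Z g) + ?s" using ks s by linarith
  then have "\<rho> * ?k \<le> frank (msum (n * m) (n * m') (\<lambda>i. kron (Y i) (Z i)) S)"
    by (intro frank_tensor_sum_aux[OF S Y \<rho>(2) Z]) assumption+
  moreover have "frank (Z g) \<le> ?k * ?s"
  proof -
    have "frank (Z g) + ?s - 1 < ?k * ?s + ?s" using dividend_less_div_times[OF s, of "frank (Z g) + ?s - 1"] by linarith
    then show ?thesis by simp
  qed
  ultimately have "?s * (\<rho> * ?k) \<le> ?s * real (frank (msum (n * m) (n * m') (\<lambda>i. kron (Y i) (Z i)) S))"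
    by (intro mult_left_mono) auto
  moreover have "\<rho> * frank (Z g) \<le> \<rho> * (?k * ?s)"
    using \<open>frank (Z g) \<le> ?k * ?s\<close> \<rho>(1) by (intro mult_left_mono) (simp_all only: of_nat_le_iff of_nat_mult[symmetric])
  ultimately show ?thesis by (simp add: mult.commute mult.left_commute)
qed

section \<open>Almost representations of a group\<close>

abbreviation "lookup \<equiv> Poly_Mapping.lookup"
abbreviation "keys \<equiv> Poly_Mapping.keys"

lemma lookup_cg_scale: "lookup (cg_scale c a) g = c * lookup a g"
  by (simp add: cg_scale_def Poly_Mapping.map.rep_eq when_def)

section \<open>Linear extension of a matrix-valued map from the group to its algebra\<close>

definition gsum :: "nat \<Rightarrow> ('g \<Rightarrow> complex mat) \<Rightarrow> ('g \<Rightarrow>\<^sub>0 complex) \<Rightarrow> complex mat" where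
  "gsum n \<phi> a = msum n n (\<lambda>g. lookup a g \<cdot>\<^sub>m \<phi> g) (keys a)"

lemma dim_gsum [simp]: "dim_row (gsum n \<phi> a) = n" "dim_col (gsum n \<phi> a) = n"
  by (simp_all add: gsum_def)

lemma index_gsum:
  assumes "\<And>g. \<phi> g \<in> carrier_mat n n" "finite S" "keys a \<subseteq> S" "i < n" "j < n"
  shows "gsum n \<phi> a $$ (i,j) = (\<Sum>g\<in>S. lookup a g * \<phi> g $$ (i,j))"
proof -
  have "gsum n \<phi> a $$ (i,j) = (\<Sum>g\<in>keys a. lookup a g * \<phi> g $$ (i,j))"
    using assms(4,5) carrier_matD[OF assms(1)] by (simp add: gsum_def index_msum)
  also have "\<dots> = (\<Sum>g\<in>S. lookup a g * \<phi> g $$ (i,j))"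
    using assms(2,3) by (intro sum.mono_neutral_left) (auto simp: in_keys_iff)
  finally show ?thesis .
qed

lemma gsum_superset:
  assumes "\<And>g. \<phi> g \<in> carrier_mat n n" "finite S" "keys a \<subseteq> S"
  shows "gsum n \<phi> a = msum n n (\<lambda>g. lookup a g \<cdot>\<^sub>m \<phi> g) S"
  using carrier_matD[OF assms(1)]
  by (intro eq_matI) (simp_all add: index_gsum[OF assms] index_msum)

lemma gsum_add:
  assumes "\<And>g. \<phi> g \<in> carrier_mat n n"
  shows "gsum n \<phi> (a + b) = gsum n \<phi> a + gsum n \<phi> b"
proof (rule eq_matI)
  fix i j assume "i < dim_row (gsum n \<phi> a + gsum n \<phi> b)" "j < dim_col (gsum n \<phi> a + gsum n \<phi> b)"
  then have ij: "i < n" "j < n" by auto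
  let ?S = "keys a \<union> keys b"
  have "keys (a + b) \<subseteq> ?S" by (rule Poly_Mapping.keys_add)
  with ij show "gsum n \<phi> (a + b) $$ (i,j) = (gsum n \<phi> a + gsum n \<phi> b) $$ (i,j)"
    by (simp add: index_gsum[OF assms, of ?S] lookup_add distrib_right sum.distrib)
qed simp_all

lemma gsum_scale:
  assumes "\<And>g. \<phi> g \<in> carrier_mat n n"
  shows "gsum n \<phi> (cg_scale c a) = c \<cdot>\<^sub>m gsum n \<phi> a"
proof (rule eq_matI)
  fix i j assume "i < dim_row (c \<cdot>\<^sub>m gsum n \<phi> a)" "j < dim_col (c \<cdot>\<^sub>m gsum n \<phi> a)"
  then have ij: "i < n" "j < n" by auto
  have "keys (cg_scale c a) \<subseteq> keys a" by (auto simp: in_keys_iff lookup_cg_scale)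
  with ij show "gsum n \<phi> (cg_scale c a) $$ (i,j) = (c \<cdot>\<^sub>m gsum n \<phi> a) $$ (i,j)"
    by (simp add: index_gsum[OF assms, of "keys a"] lookup_cg_scale sum_distrib_left mult.assoc)
qed simp_all

lemma gsum_single:
  assumes "\<And>g. \<phi> g \<in> carrier_mat n n"
  shows "gsum n \<phi> (Poly_Mapping.single g c) = c \<cdot>\<^sub>m \<phi> g"
  using carrier_matD[OF assms]
  by (intro eq_matI) (simp_all add: index_gsum[OF assms, of "{g}"] lookup_single)

lemma gsum_zero: "gsum n \<phi> 0 = 0\<^sub>m n n"
  by (rule eq_matI) (simp_all add: gsum_def index_msum)

lemma gsum_diff_single:
  assumes "\<And>g. \<phi> g \<in> carrier_mat n n"
  shows "gsum n \<phi> (Poly_Mapping.single g 1 - Poly_Mapping.single h 1) = \<phi> g - \<phi> h"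
proof (rule eq_matI)
  fix i j assume "i < dim_row (\<phi> g - \<phi> h)" "j < dim_col (\<phi> g - \<phi> h)"
  then have ij: "i < n" "j < n" using carrier_matD[OF assms] by auto
  let ?a = "Poly_Mapping.single g 1 - Poly_Mapping.single h (1::complex)"
  have k: "keys ?a \<subseteq> {g, h}"
    by (auto simp: in_keys_iff lookup_minus lookup_single when_def split: if_splits)
  show "gsum n \<phi> ?a $$ (i,j) = (\<phi> g - \<phi> h) $$ (i,j)"
    using ij carrier_matD[OF assms]
    by (cases "g = h") (simp_all add: gsum_zero index_gsum[OF assms _ k] lookup_minus lookup_single)
qed (use carrier_matD[OF assms] in simp_all)

section \<open>Almost representations of the group, direct sums and tensor products\<close>

text \<open>The rank of each defect takes the place of the codimension of the subspace on which
  \<open>\<psi>\<close> is multiplicative, so no subspace has to be carried along. The condition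
  \<open>0 < n\<close> is explicit because the bound is not strict; in \<open>almost_rep\<close> the
  strict dimension bound already excludes dimension zero.\<close>

definition arep :: "nat \<Rightarrow> 'g::group_add set \<Rightarrow> real \<Rightarrow> ('g \<Rightarrow> complex mat) \<Rightarrow> bool" where
  "arep n F e \<phi> \<longleftrightarrow> 0 < n \<and> (\<forall>g. \<phi> g \<in> carrier_mat n n) \<and> \<phi> 0 = 1\<^sub>m n \<and>
     (\<forall>g\<in>F. \<forall>h\<in>F. real (frank (\<phi> g * \<phi> h - \<phi> (g + h))) \<le> e * n)"

lemma arepD:
  assumes "arep n F e \<phi>"
  shows "0 < n" "\<And>g. \<phi> g \<in> carrier_mat n n" "\<And>g. dim_row (\<phi> g) = n" "\<And>g. dim_col (\<phi> g) = n"
    "\<phi> 0 = 1\<^sub>m n" "\<And>g h. g \<in> F \<Longrightarrow> h \<in> F \<Longrightarrow> real (frank (\<phi> g * \<phi> h - \<phi> (g + h))) \<le> e * n"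
proof -
  show c: "\<And>g. \<phi> g \<in> carrier_mat n n" using assms by (simp add: arep_def)
  show "\<And>g. dim_row (\<phi> g) = n" "\<And>g. dim_col (\<phi> g) = n" using carrier_matD[OF c] by auto
qed (use assms in \<open>auto simp: arep_def\<close>)

lemma arep_mono:
  assumes "arep n F e \<phi>" "F' \<subseteq> F" "e \<le> e'"
  shows "arep n F' e' \<phi>"
proof -
  have "e * n \<le> e' * n" using assms(3) by (intro mult_right_mono) auto
  with assms show ?thesis unfolding arep_def by (meson order_trans subsetD)
qed

text \<open>\<open>\<phi> g * \<phi> (- g)\<close> differs from the identity by rank at most
  \<open>e * n\<close>, and its rank does not exceed that of \<open>\<phi> g\<close>.\<close>

lemma arep_frank_ge:
  assumes "arep n F e \<phi>" "g \<in> F" "- g \<in> F"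
  shows "real n - e * real n \<le> real (frank (\<phi> g))"
proof -
  note d = arepD[OF assms(1)]
  have "frank (1\<^sub>m n :: complex mat) \<le> frank (\<phi> g * \<phi> (- g)) + frank (1\<^sub>m n - \<phi> g * \<phi> (- g))"
    using d by (intro frank_le_minus) simp_all
  moreover have "1\<^sub>m n - \<phi> g * \<phi> (- g) = (-1) \<cdot>\<^sub>m (\<phi> g * \<phi> (- g) - \<phi> (g + - g))"
    using d(3,4) by (intro eq_matI) (simp_all add: d(5))
  moreover have "frank (\<phi> g * \<phi> (- g)) \<le> frank (\<phi> g)" using d by (intro frank_mult_le1) simp
  ultimately have "n \<le> frank (\<phi> g) + frank (\<phi> g * \<phi> (- g) - \<phi> (g + - g))"
    using frank_smult_le[of "-1" "\<phi> g * \<phi> (- g) - \<phi> (g + - g)"] by simp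
  with d(6)[OF assms(2,3)] show ?thesis by linarith
qed

text \<open>The defect telescopes by changing one tensor factor at a time. Each of the two terms has
  relative rank at most that of the defect \<open>E\<close> or \<open>E'\<close> in it, so relative
  errors add.\<close>

lemma arep_kron:
  assumes "arep n F e \<phi>" "arep m F e' \<psi>"
  shows "arep (n * m) F (e + e') (\<lambda>g. kron (\<phi> g) (\<psi> g))"
proof -
  note d = arepD[OF assms(1)] and d' = arepD[OF assms(2)]
  show ?thesis
    unfolding arep_def
  proof (intro conjI allI ballI)
    show "0 < n * m" using d(1) d'(1) by simp
    show "kron (\<phi> g) (\<psi> g) \<in> carrier_mat (n * m) (n * m)" for g
      using d(3,4) d'(3,4) by (intro carrier_matI) simp_all
    show "kron (\<phi> 0) (\<psi> 0) = 1\<^sub>m (n * m)" by (simp add: d(5) d'(5) kron_one)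
    fix g h assume gh: "g \<in> F" "h \<in> F"
    let ?E = "\<phi> g * \<phi> h - \<phi> (g + h)" and ?E' = "\<psi> g * \<psi> h - \<psi> (g + h)"
    have eq: "kron (\<phi> g) (\<psi> g) * kron (\<phi> h) (\<psi> h) - kron (\<phi> (g + h)) (\<psi> (g + h))
      = kron ?E (\<psi> g * \<psi> h) + kron (\<phi> (g + h)) ?E'"
      using d(3,4) d'(3,4)
      by (simp add: kron_mult kron_minus_left kron_minus_right) (intro eq_matI, simp_all)
    have "frank (kron ?E (\<psi> g * \<psi> h) + kron (\<phi> (g + h)) ?E') \<le>
      frank (kron ?E (\<psi> g * \<psi> h)) + frank (kron (\<phi> (g + h)) ?E')"
      using d(3,4) d'(3,4) by (intro frank_add) simp_all
    moreover have "frank (kron ?E (\<psi> g * \<psi> h)) \<le> frank ?E * m"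
      using frank_kron_le_left[of ?E "\<psi> g * \<psi> h"] d'(3) by simp
    moreover have "frank (kron (\<phi> (g + h)) ?E') \<le> n * frank ?E'"
      using frank_kron_le_right[of "\<phi> (g + h)" ?E'] d(4) by simp
    ultimately have "frank (kron ?E (\<psi> g * \<psi> h) + kron (\<phi> (g + h)) ?E') \<le> frank ?E * m + n * frank ?E'"
      by linarith
    then have "real (frank (kron (\<phi> g) (\<psi> g) * kron (\<phi> h) (\<psi> h) - kron (\<phi> (g + h)) (\<psi> (g + h))))
      \<le> real (frank ?E * m + n * frank ?E')"
      unfolding eq by (simp only: of_nat_le_iff)
    also have "\<dots> = real (frank ?E) * m + n * real (frank ?E')" by simp
    also have "\<dots> \<le> (e * n) * m + n * (e' * m)"
      using d(6)[OF gh] d'(6)[OF gh] by (intro add_mono mult_right_mono mult_left_mono) auto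
    finally show "real (frank (kron (\<phi> g) (\<psi> g) * kron (\<phi> h) (\<psi> h) - kron (\<phi> (g + h)) (\<psi> (g + h))))
      \<le> (e + e') * real (n * m)" by (simp add: algebra_simps)
  qed
qed

definition one_plus :: "nat \<Rightarrow> complex mat \<Rightarrow> complex mat" where
  "one_plus m X = four_block_mat (1\<^sub>m m) (0\<^sub>m m m) (0\<^sub>m m m) X"

text \<open>The defect is \<open>0 \<oplus> E\<close>, whose rank is no larger than that of
  \<open>E\<close>, while the dimension doubles.\<close>

lemma arep_one_plus:
  assumes "arep m F e \<phi>"
  shows "arep (m + m) F e (\<lambda>g. one_plus m (\<phi> g))"
proof -
  note d = arepD[OF assms]
  show ?thesis
    unfolding arep_def
  proof (intro conjI allI ballI)
    show "0 < m + m" using d(1) by simp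
    show "one_plus m (\<phi> g) \<in> carrier_mat (m + m) (m + m)" for g
      using d(3,4) by (intro carrier_matI) (simp_all add: one_plus_def)
    show "one_plus m (\<phi> 0) = 1\<^sub>m (m + m)" by (simp add: d(5) one_plus_def)
    fix g h assume gh: "g \<in> F" "h \<in> F"
    let ?E = "\<phi> g * \<phi> h - \<phi> (g + h)"
    have "one_plus m (\<phi> g) * one_plus m (\<phi> h) = four_block_mat
      (1\<^sub>m m * 1\<^sub>m m + 0\<^sub>m m m * 0\<^sub>m m m) (1\<^sub>m m * 0\<^sub>m m m + 0\<^sub>m m m * \<phi> h)
      (0\<^sub>m m m * 1\<^sub>m m + \<phi> g * 0\<^sub>m m m) (0\<^sub>m m m * 0\<^sub>m m m + \<phi> g * \<phi> h)"
      unfolding one_plus_def using d(2) by (intro mult_four_block_mat[of _ m m _ m _ m _ _ m _ m]) auto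
    also have "\<dots> = four_block_mat (1\<^sub>m m) (0\<^sub>m m m) (0\<^sub>m m m) (\<phi> g * \<phi> h)"
      using d(3,4) by (intro cong_four_block_mat) (auto intro!: eq_matI)
    finally have "one_plus m (\<phi> g) * one_plus m (\<phi> h) - one_plus m (\<phi> (g + h)) =
      four_block_mat (0\<^sub>m m m) (0\<^sub>m m m) (0\<^sub>m m m) ?E"
      using d(3,4) by (intro eq_matI) (auto simp: one_plus_def)
    moreover have "frank (four_block_mat (0\<^sub>m m m) (0\<^sub>m m m) (0\<^sub>m m m) ?E) \<le> frank ?E"
    proof -
      obtain U V where U: "U \<in> carrier_mat (dim_row ?E) (frank ?E)" and V: "V \<in> carrier_mat (frank ?E) (dim_col ?E)"
        and E: "?E = U * V" using frank_full_factorization[of ?E] by metis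
      note dU = carrier_matD[OF U] carrier_matD[OF V]
      have "(0\<^sub>m m (frank ?E) @\<^sub>r U) * (0\<^sub>m (frank ?E) m @\<^sub>c V) =
        four_block_mat (0\<^sub>m m m) (0\<^sub>m m m) (0\<^sub>m m m) ?E"
        unfolding E[symmetric] using dU d(3,4)
        by (subst append_rows_mult_append_cols) (simp_all add: mat_zero_mult mat_mult_zero E[symmetric])
      then show ?thesis
        using frank_leI[of "0\<^sub>m m (frank ?E) @\<^sub>r U" "0\<^sub>m (frank ?E) m @\<^sub>c V"] dU by simp
    qed
    ultimately have "real (frank (one_plus m (\<phi> g) * one_plus m (\<phi> h) - one_plus m (\<phi> (g + h)))) \<le> frank ?E"
      by simp
    with d(6)[OF gh] have 1: "real (frank (one_plus m (\<phi> g) * one_plus m (\<phi> h) - one_plus m (\<phi> (g + h)))) \<le> e * m"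
      by linarith
    then have "0 \<le> e * m" by linarith
    with 1 show "real (frank (one_plus m (\<phi> g) * one_plus m (\<phi> h) - one_plus m (\<phi> (g + h)))) \<le> e * real (m + m)"
      by (simp add: algebra_simps)
  qed
qed

text \<open>\<open>X - Y\<close> is not itself a value of an almost representation. As a compression
  of \<open>1 \<oplus> X\<close> it can still bound ranks from below, since compressing never raises
  the rank.\<close>

lemma one_plus_compress:
  assumes X: "X \<in> carrier_mat m m" and Y: "Y \<in> carrier_mat m m"
  shows "(((-1) \<cdot>\<^sub>m Y) @\<^sub>c 1\<^sub>m m) * one_plus m X * (1\<^sub>m m @\<^sub>r 1\<^sub>m m) = X - Y"
proof -
  note d = carrier_matD[OF X] carrier_matD[OF Y]
  have "one_plus m X * (1\<^sub>m m @\<^sub>r 1\<^sub>m m) = four_block_mat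
    (1\<^sub>m m * 1\<^sub>m m + 0\<^sub>m m m * 1\<^sub>m m) (1\<^sub>m m * 0\<^sub>m m 0 + 0\<^sub>m m m * 0\<^sub>m m 0)
    (0\<^sub>m m m * 1\<^sub>m m + X * 1\<^sub>m m) (0\<^sub>m m m * 0\<^sub>m m 0 + X * 0\<^sub>m m 0)"
    unfolding one_plus_def append_rows_def index_one_mat using X by (intro mult_four_block_mat[of _ m m _ m _ m _ _ m _ 0]) auto
  also have "\<dots> = 1\<^sub>m m @\<^sub>r X"
    unfolding append_rows_def using d by (intro cong_four_block_mat) (auto intro!: eq_matI simp: mat_mult_one)
  finally have "one_plus m X * (1\<^sub>m m @\<^sub>r 1\<^sub>m m) = 1\<^sub>m m @\<^sub>r X" .
  then have "(((-1) \<cdot>\<^sub>m Y) @\<^sub>c 1\<^sub>m m) * one_plus m X * (1\<^sub>m m @\<^sub>r 1\<^sub>m m) = (((-1) \<cdot>\<^sub>m Y) @\<^sub>c 1\<^sub>m m) * (1\<^sub>m m @\<^sub>r X)"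
    using d by (subst mat_assoc) (simp_all add: one_plus_def)
  also have "\<dots> = ((-1) \<cdot>\<^sub>m Y) * 1\<^sub>m m + 1\<^sub>m m * X"
    using d by (intro append_cols_mult_append_rows) simp_all
  also have "\<dots> = X - Y"
    using d by (simp add: mat_mult_one mat_one_mult) (intro eq_matI, simp_all)
  finally show ?thesis .
qed

section \<open>Uniform rank bounds, null elements and amplification\<close>

text \<open>\<open>d\<close> comes before \<open>F\<close> and \<open>e\<close>, so the negation of
  \<open>good {p}\<close> is the group version of membership in the sofic radical. All of
  \<open>T\<close> shares one \<open>\<phi>\<close>, because the tensor argument needs the bound for
  altered coefficients that are known only after \<open>\<phi>\<close> is fixed.\<close>

definition good :: "('g::group_add \<Rightarrow>\<^sub>0 complex) set \<Rightarrow> bool" where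
  "good T \<longleftrightarrow> (\<exists>d>0. \<forall>F e. finite F \<longrightarrow> 0 < e \<longrightarrow>
     (\<exists>n \<phi>. arep n F e \<phi> \<and> (\<forall>a\<in>T. d * real n \<le> frank (gsum n \<phi> a))))"

text \<open>This is the group version of the rank radical: \<open>F\<close> plays the part of
  \<open>L\<close> and is fixed before \<open>d\<close>, so only the error \<open>e\<close> may
  react to \<open>d\<close>.\<close>

definition rank_null :: "('g::group_add \<Rightarrow>\<^sub>0 complex) \<Rightarrow> bool" where
  "rank_null p \<longleftrightarrow> (\<exists>F. finite F \<and> (\<forall>d>0. \<exists>e>0. \<forall>n \<phi>. arep n F e \<phi> \<longrightarrow> frank (gsum n \<phi> p) < d * real n))"

definition sep :: "'g::group_add \<Rightarrow> 'g \<Rightarrow> bool" where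
  "sep g h \<longleftrightarrow> (\<forall>F e. finite F \<longrightarrow> 0 < e \<longrightarrow>
     (\<exists>n \<phi>. arep n F e \<phi> \<and> n \<le> 4 * frank (\<phi> g - \<phi> h)))"

lemma good_subset: "good T \<Longrightarrow> T' \<subseteq> T \<Longrightarrow> good T'"
  unfolding good_def by (meson subsetD)

text \<open>Tensor squares are iterated until the relative rank reaches \<open>1/4\<close>. Below
  this threshold \<open>frank_kron_diff\<close> increases it by a factor of at least
  \<open>5/4\<close> per step, provided \<open>\<phi> g\<close> has nearly full rank.\<close>

lemma sep_if_not_rank_null:
  fixes g h :: "'g::group_add"
  assumes "\<not> rank_null (Poly_Mapping.single g 1 - Poly_Mapping.single h 1)"
  shows "sep g h"
  unfolding sep_def
proof (intro allI impI)
  fix F :: "'g set" and e :: real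
  assume F: "finite F" and e: "0 < e"
  let ?p = "Poly_Mapping.single g 1 - Poly_Mapping.single h (1::complex)"
  \<comment> \<open>With \<open>g\<close> and \<open>- g\<close> among the tested elements,
    \<open>arep_frank_ge\<close> forces \<open>\<phi> g\<close> to have nearly full rank.\<close>
  define F' where "F' = insert g (insert (- g) F)"
  have "finite F'" using F by (simp add: F'_def)
  with assms obtain d where d: "0 < d"
    and ex: "\<And>e. 0 < e \<Longrightarrow> \<exists>n \<phi>. arep n F' e \<phi> \<and> d * real n \<le> frank (gsum n \<phi> ?p)"
    unfolding rank_null_def by (meson not_less)
  have step: "\<exists>n \<phi>. arep n F' e \<phi> \<and> (n \<le> 4 * frank (\<phi> g - \<phi> h) \<or> d * (5/4) ^ k * real n \<le> frank (\<phi> g - \<phi> h))"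
    if "0 < e" for e k
    using that
  proof (induction k arbitrary: e)
    case 0
    from ex[OF this] obtain n \<phi> where \<phi>: "arep n F' e \<phi>" and "d * real n \<le> frank (gsum n \<phi> ?p)" by blast
    then have "d * (5/4) ^ 0 * real n \<le> frank (\<phi> g - \<phi> h)" by (simp add: gsum_diff_single[OF arepD(2)[OF \<phi>]])
    with \<phi> show ?case by blast
  next
    case (Suc k)
    \<comment> \<open>The bound \<open>e / 2\<close> pays for the doubling of the error in a tensor
      square; the bound \<open>1 / 8\<close> gives \<open>\<phi> g\<close> rank at least
      \<open>7/8 n\<close>.\<close>
    have "0 < min (e / 2) (1 / 8)" using Suc.prems by simp
    from Suc.IH[OF this] obtain n \<phi> where \<phi>: "arep n F' (min (e / 2) (1 / 8)) \<phi>"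
      and or: "n \<le> 4 * frank (\<phi> g - \<phi> h) \<or> d * (5/4) ^ k * real n \<le> frank (\<phi> g - \<phi> h)" by blast
    note a = arepD[OF \<phi>]
    show ?case
    proof (cases "n \<le> 4 * frank (\<phi> g - \<phi> h)")
      case True
      moreover have "arep n F' e \<phi>" using Suc.prems by (intro arep_mono[OF \<phi>]) auto
      ultimately show ?thesis by blast
    next
      case False
      let ?r = "frank (\<phi> g - \<phi> h)" and ?R = "frank (\<phi> g)"
      let ?\<psi> = "\<lambda>x. kron (\<phi> x) (\<phi> x)"
      have big: "d * (5/4) ^ k * real n \<le> ?r" and r: "4 * real ?r < n" using or False by auto
      have "real n - min (e / 2) (1 / 8) * real n \<le> ?R"
        by (rule arep_frank_ge[OF \<phi>]) (auto simp: F'_def)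
      moreover have "min (e / 2) (1 / 8) * real n \<le> 1 / 8 * real n" by (intro mult_right_mono) auto
      ultimately have R: "7 / 8 * real n \<le> ?R" by linarith
      with r have rR: "?r \<le> ?R" by linarith
      have "(?R - ?r) * ?r + ?r * (?R - ?r) \<le> frank (?\<psi> g - ?\<psi> h)"
        by (rule frank_kron_diff) (rule a(2))+
      then have "real ((?R - ?r) * ?r + ?r * (?R - ?r)) \<le> frank (?\<psi> g - ?\<psi> h)"
        by (simp only: of_nat_le_iff)
      then have 1: "2 * (real ?R - ?r) * ?r \<le> frank (?\<psi> g - ?\<psi> h)"
      proof -
        have "real ((?R - ?r) * ?r + ?r * (?R - ?r)) = 2 * (real ?R - ?r) * ?r"
          using rR by (simp only: of_nat_add of_nat_mult of_nat_diff) (simp add: algebra_simps)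
        then show ?thesis using \<open>real ((?R - ?r) * ?r + ?r * (?R - ?r)) \<le> _\<close> by linarith
      qed
      \<comment> \<open>The growth factor arises as \<open>2 * (7/8 - 1/4) = 5/4\<close>.\<close>
      have "d * (5/4) ^ Suc k * real (n * n) = (5/4 * real n) * (d * (5/4) ^ k * real n)" by simp
      also have "\<dots> \<le> (5/4 * real n) * ?r" using big by (intro mult_left_mono) auto
      also have "\<dots> \<le> 2 * (real ?R - ?r) * ?r" using R r by (intro mult_right_mono) auto
      also note 1
      finally have "d * (5/4) ^ Suc k * real (n * n) \<le> frank (?\<psi> g - ?\<psi> h)" .
      moreover have "arep (n * n) F' e ?\<psi>"
        using Suc.prems by (intro arep_mono[OF arep_kron[OF \<phi> \<phi>]]) auto
      ultimately show ?thesis by blast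
    qed
  qed
  \<comment> \<open>\<open>k\<close> depends on \<open>d\<close> and thereby on \<open>F\<close>,
    but \<open>step\<close> offers every \<open>k\<close> with an arbitrarily small error, and the
    final bound \<open>1/4\<close> no longer refers to \<open>d\<close>.\<close>
  obtain k where k: "1 / (4 * d) < (5/4 :: real) ^ k" using real_arch_pow[of "5/4"] by auto
  from step[OF e, of k] obtain n \<phi> where \<phi>: "arep n F' e \<phi>"
    and or: "n \<le> 4 * frank (\<phi> g - \<phi> h) \<or> d * (5/4) ^ k * real n \<le> frank (\<phi> g - \<phi> h)" by blast
  have "1 / 4 \<le> d * (5/4) ^ k" using k d by (simp add: field_simps)
  then have "1 / 4 * real n \<le> d * (5/4) ^ k * real n" by (intro mult_right_mono) auto
  then have "n \<le> 4 * frank (\<phi> g - \<phi> h)" using or by linarith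
  moreover have "arep n F e \<phi>" by (rule arep_mono[OF \<phi>]) (auto simp: F'_def)
  ultimately show "\<exists>n \<phi>. arep n F e \<phi> \<and> n \<le> 4 * frank (\<phi> g - \<phi> h)" by blast
qed

text \<open>The trivial one-dimensional representation is exact and sends such an element to its
  nonzero coefficient, a matrix of full rank. This starts the induction on the support with
  \<open>d = 1\<close>.\<close>

lemma good_singleton: "good {a. keys a \<subseteq> {g} \<and> lookup a (g :: 'g::group_add) \<noteq> 0}"
  unfolding good_def
proof (intro exI[of _ "1::real"] conjI allI impI)
  fix F :: "'g set" and e :: real
  assume "finite F" "0 < e"
  have z: "1\<^sub>m 1 * 1\<^sub>m 1 - 1\<^sub>m 1 = (0\<^sub>m 1 1 :: complex mat)" by (rule eq_matI) auto
  have c: "(\<lambda>_. 1\<^sub>m 1) x \<in> carrier_mat 1 1" for x :: 'g by simp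
  have "arep 1 F e (\<lambda>_. 1\<^sub>m 1)" unfolding arep_def z using \<open>0 < e\<close> by simp
  moreover have "1 * real 1 \<le> frank (gsum 1 (\<lambda>_. 1\<^sub>m 1) a)"
    if a: "keys a \<subseteq> {g}" "lookup a g \<noteq> 0" for a
  proof -
    have "inverse (lookup a g) \<cdot>\<^sub>m gsum 1 (\<lambda>_. 1\<^sub>m 1) a = 1\<^sub>m 1"
      using a index_gsum[OF c _ a(1), of 0 0] by (intro eq_matI) auto
    then have "frank (1\<^sub>m 1 :: complex mat) \<le> frank (gsum 1 (\<lambda>_. 1\<^sub>m 1) a)"
      using frank_smult_le[of "inverse (lookup a g)" "gsum 1 (\<lambda>_. 1\<^sub>m 1) a"] by simp
    then show ?thesis by simp
  qed
  ultimately show "\<exists>n \<phi>. arep n F e \<phi> \<and>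
      (\<forall>a\<in>{a. keys a \<subseteq> {g} \<and> lookup a g \<noteq> 0}. 1 * real n \<le> frank (gsum n \<phi> a))" by blast
qed simp

lemma exists_lookup_eq:
  assumes "finite T"
  obtains b where "keys b \<subseteq> T" "\<And>i. i \<in> T \<Longrightarrow> lookup b i = f i"
proof -
  have "finite {x. (if x \<in> T then f x else 0) \<noteq> 0}"
    using assms by (rule rev_finite_subset) (auto split: if_splits)
  then have l: "lookup (Abs_poly_mapping (\<lambda>x. if x \<in> T then f x else 0)) = (\<lambda>x. if x \<in> T then f x else 0)"
    by (rule Abs_poly_mapping_inverse[OF CollectI])
  show thesis
    by (rule that[of "Abs_poly_mapping (\<lambda>x. if x \<in> T then f x else 0)"])
      (auto simp: l in_keys_iff split: if_splits)
qed

text \<open>Compressing \<open>\<Sum>i. a i Y i \<otimes> (1 \<oplus> X i)\<close> by \<open>(- X h, 1)\<close> and \<open>(1, 1)\<close> gives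
  \<open>\<Sum>i. a i Y i \<otimes> (X i - X h)\<close>, which no longer involves \<open>h\<close>.\<close>

lemma good_insert:
  fixes g h :: "'g::group_add"
  assumes T: "finite T" "g \<in> T" and sep: "sep g h"
    and good: "good {a. keys a \<subseteq> T \<and> lookup a g \<noteq> 0}"
  shows "good {a. keys a \<subseteq> insert h T \<and> lookup a g \<noteq> 0}"
proof -
  from good obtain d where d: "0 < d" and ex: "\<And>F e. finite F \<Longrightarrow> 0 < e \<Longrightarrow>
     \<exists>n \<phi>. arep n F e \<phi> \<and> (\<forall>a\<in>{a. keys a \<subseteq> T \<and> lookup a g \<noteq> 0}. d * real n \<le> frank (gsum n \<phi> a))"
    unfolding good_def by blast
  have cT: "0 < card T" using T by (auto simp: card_gt_0_iff)
  show ?thesis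
    unfolding good_def
  \<comment> \<open>In the constant, a factor 4 comes from \<open>sep\<close>, a factor 2 from the
    doubled dimension of \<open>1 \<oplus> \<psi>\<close>, and \<open>card T\<close> from
    \<open>frank_tensor_sum\<close>. None of them depends on \<open>F\<close> or
    \<open>e\<close>.\<close>
  proof (intro exI[of _ "d / (8 * card T)"] conjI allI impI)
    show "0 < d / (8 * card T)" using d cT by simp
    fix F :: "'g set" and e :: real
    assume F: "finite F" and e: "0 < e"
    from ex[OF F half_gt_zero[OF e]] obtain n \<phi> where \<phi>: "arep n F (e / 2) \<phi>"
      and \<phi>T: "\<And>a. keys a \<subseteq> T \<Longrightarrow> lookup a g \<noteq> 0 \<Longrightarrow> d * real n \<le> frank (gsum n \<phi> a)" by blast
    from sep F half_gt_zero[OF e] obtain m \<psi> where \<psi>: "arep m F (e / 2) \<psi>"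
      and sep': "m \<le> 4 * frank (\<psi> g - \<psi> h)" unfolding sep_def by blast
    note a = arepD[OF \<phi>] and b = arepD[OF \<psi>]
    let ?\<chi> = "\<lambda>x. kron (\<phi> x) (one_plus m (\<psi> x))"
    have \<chi>: "arep (n * (m + m)) F (e / 2 + e / 2) ?\<chi>" by (rule arep_kron[OF \<phi> arep_one_plus[OF \<psi>]])
    have dop: "dim_row (one_plus m (\<psi> x)) = m + m" "dim_col (one_plus m (\<psi> x)) = m + m" for x
      using b(3,4) by (simp_all add: one_plus_def)
    have "d / (8 * card T) * real (n * (m + m)) \<le> frank (gsum (n * (m + m)) ?\<chi> p)"
      if p: "keys p \<subseteq> insert h T" "lookup p g \<noteq> 0" for p
    proof -
      let ?S = "insert h T"
      let ?L = "((-1) \<cdot>\<^sub>m \<psi> h) @\<^sub>c 1\<^sub>m m" and ?C = "1\<^sub>m m @\<^sub>r 1\<^sub>m m :: complex mat"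
      let ?G = "gsum (n * (m + m)) ?\<chi> p"
      have dLC: "dim_row ?L = m" "dim_col ?L = m + m" "dim_row ?C = m + m" "dim_col ?C = m"
        using b(3,4) by simp_all
      \<comment> \<open>The coefficients of \<open>p\<close> are moved into the first tensor factor,
        so that the compression acts on a second factor that is free of them.\<close>
      have G: "?G = msum (n * (m + m)) (n * (m + m)) (\<lambda>i. kron (lookup p i \<cdot>\<^sub>m \<phi> i) (one_plus m (\<psi> i))) ?S"
        unfolding gsum_superset[OF arepD(2)[OF \<chi>] finite.insertI[OF T(1)] p(1)]
      proof (rule msum_cong[OF refl])
        fix i
        show "lookup p i \<cdot>\<^sub>m ?\<chi> i = kron (lookup p i \<cdot>\<^sub>m \<phi> i) (one_plus m (\<psi> i))"
          using a(3,4) dop by (intro eq_matI) (auto simp: index_kron div_mod_less_times)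
      qed
      have c1: "kron (lookup p i \<cdot>\<^sub>m \<phi> i) (one_plus m (\<psi> i)) \<in> carrier_mat (n * (m + m)) (n * (m + m))" for i
        using a(3,4) dop by (intro carrier_matI) simp_all
      have "kron (1\<^sub>m n) ?L * ?G * kron (1\<^sub>m n) ?C =
        msum (n * m) (n * (m + m)) (\<lambda>i. kron (lookup p i \<cdot>\<^sub>m \<phi> i) (?L * one_plus m (\<psi> i))) ?S * kron (1\<^sub>m n) ?C"
        unfolding G using a(3,4) dop dLC c1
        by (subst mult_msum) (auto intro!: arg_cong[of _ _ "\<lambda>M. M * _"] msum_cong simp: kron_mult mat_one_mult)
      also have "\<dots> = msum (n * m) (n * m) (\<lambda>i. kron (lookup p i \<cdot>\<^sub>m \<phi> i) (?L * one_plus m (\<psi> i) * ?C)) ?S"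
      proof (subst msum_mult)
        show "kron (lookup p i \<cdot>\<^sub>m \<phi> i) (?L * one_plus m (\<psi> i)) \<in> carrier_mat (n * m) (n * (m + m))" for i
          using a(3,4) dop dLC by (intro carrier_matI) simp_all
      qed (use a(3,4) dop dLC in \<open>auto intro!: msum_cong simp: kron_mult mat_mult_one\<close>)
      also have "\<dots> = msum (n * m) (n * m) (\<lambda>i. kron (lookup p i \<cdot>\<^sub>m \<phi> i) (\<psi> i - \<psi> h)) ?S"
        by (intro msum_cong refl) (simp add: one_plus_compress[OF b(2) b(2)])
      also have "\<dots> = msum (n * m) (n * m) (\<lambda>i. kron (lookup p i \<cdot>\<^sub>m \<phi> i) (\<psi> i - \<psi> h)) T"
      proof (cases "h \<in> T")
        case True
        then show ?thesis by (simp add: insert_absorb)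
      next
        case False
        have "kron (lookup p h \<cdot>\<^sub>m \<phi> h) (\<psi> h - \<psi> h) = 0\<^sub>m (n * m) (n * m)"
          using a(3,4) b(3,4) by (simp add: mat_minus_self kron_zero_right)
        then show ?thesis using False T(1) by (intro eq_matI) (simp_all add: index_msum)
      qed
      finally have K: "kron (1\<^sub>m n) ?L * ?G * kron (1\<^sub>m n) ?C =
        msum (n * m) (n * m) (\<lambda>i. kron (lookup p i \<cdot>\<^sub>m \<phi> i) (\<psi> i - \<psi> h)) T" .
      have "frank (kron (1\<^sub>m n) ?L * ?G * kron (1\<^sub>m n) ?C) \<le> frank (kron (1\<^sub>m n) ?L * ?G)"
        using dLC by (intro frank_mult_le1) simp
      also have "\<dots> \<le> frank ?G" using dLC by (intro frank_mult_le2) simp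
      finally have le: "frank (msum (n * m) (n * m) (\<lambda>i. kron (lookup p i \<cdot>\<^sub>m \<phi> i) (\<psi> i - \<psi> h)) T) \<le> frank ?G"
        unfolding K .
      have "(d * real n) * frank (\<psi> g - \<psi> h) \<le>
        card T * frank (msum (n * m) (n * m) (\<lambda>i. kron (lookup p i \<cdot>\<^sub>m \<phi> i) (\<psi> i - \<psi> h)) T)"
      proof (rule frank_tensor_sum[OF T])
        show "lookup p i \<cdot>\<^sub>m \<phi> i \<in> carrier_mat n n" for i using a(2) by simp
        show "\<psi> i - \<psi> h \<in> carrier_mat m m" for i using b(3,4) by (intro carrier_matI) simp_all
        show "0 \<le> d * real n" using d by simp
        fix x :: "'g \<Rightarrow> complex" assume x: "x g \<noteq> 0"
        \<comment> \<open>\<open>q\<close> absorbs the multipliers \<open>x\<close> into the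
          coefficients of \<open>p\<close>. Its coefficient at \<open>g\<close> stays nonzero, so
          the bound that holds for all elements supported on \<open>T\<close> covers it too.\<close>
        obtain q where q: "keys q \<subseteq> T" "\<And>i. i \<in> T \<Longrightarrow> lookup q i = x i * lookup p i"
          using exists_lookup_eq[OF T(1), of "\<lambda>i. x i * lookup p i"] by metis
        have "d * real n \<le> frank (gsum n \<phi> q)"
          using q x p(2) T(2) by (intro \<phi>T) auto
        also have "gsum n \<phi> q = msum n n (\<lambda>i. x i \<cdot>\<^sub>m (lookup p i \<cdot>\<^sub>m \<phi> i)) T"
          unfolding gsum_superset[OF a(2) T(1) q(1)]
          using q(2) a(3,4) by (intro msum_cong refl) (auto intro!: eq_matI)
        finally show "d * real n \<le> frank (msum n n (\<lambda>i. x i \<cdot>\<^sub>m (lookup p i \<cdot>\<^sub>m \<phi> i)) T)" .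
      qed
      also have "\<dots> \<le> real (card T * frank ?G)"
        using le by (simp only: of_nat_le_iff mult_le_mono2 of_nat_mult[symmetric])
      finally have "(d * real n) * frank (\<psi> g - \<psi> h) \<le> card T * real (frank ?G)" by simp
      moreover have "(d * real n) * (real m / 4) \<le> (d * real n) * frank (\<psi> g - \<psi> h)"
        using sep' d by (intro mult_left_mono) auto
      ultimately have "(d * real n) * (real m / 4) \<le> card T * real (frank ?G)" by linarith
      then show ?thesis using cT by (simp add: field_simps)
    qed
    with \<chi> show "\<exists>n \<phi>. arep n F e \<phi> \<and>
      (\<forall>a\<in>{a. keys a \<subseteq> insert h T \<and> lookup a g \<noteq> 0}. d / (8 * card T) * real n \<le> frank (gsum n \<phi> a))"
      by (intro exI[of _ "n * (m + m)"] exI[of _ ?\<chi>]) auto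
  qed
qed

lemma good_if_sep:
  assumes "finite U" "\<And>h. h \<in> U \<Longrightarrow> sep g h"
  shows "good {a. keys a \<subseteq> insert g U \<and> lookup a g \<noteq> 0}"
  using assms
proof (induction U)
  case empty
  then show ?case by (simp add: good_singleton)
next
  case (insert h U)
  have "good {a. keys a \<subseteq> insert h (insert g U) \<and> lookup a g \<noteq> 0}"
    using insert by (intro good_insert[of "insert g U" g h]) auto
  then show ?case by (simp add: insert_commute)
qed

section \<open>Closure properties of null elements and induction on the support\<close>

lemma rank_null_zero: "rank_null 0"
  unfolding rank_null_def
proof (intro exI[of _ "{}"] conjI allI impI)
  fix d :: real assume "0 < d"
  then show "\<exists>e>0. \<forall>n \<phi>. arep n {} e \<phi> \<longrightarrow> frank (gsum n \<phi> 0) < d * real n"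
    by (intro exI[of _ 1]) (auto simp: gsum_zero dest: arepD(1))
qed simp

lemma rank_null_add:
  assumes "rank_null p" "rank_null q"
  shows "rank_null (p + q)"
proof -
  from assms(1) obtain F where F: "finite F"
    "\<And>d. d > 0 \<Longrightarrow> \<exists>e>0. \<forall>n \<phi>. arep n F e \<phi> \<longrightarrow> frank (gsum n \<phi> p) < d * real n"
    unfolding rank_null_def by blast
  from assms(2) obtain F' where F': "finite F'"
    "\<And>d. d > 0 \<Longrightarrow> \<exists>e>0. \<forall>n \<phi>. arep n F' e \<phi> \<longrightarrow> frank (gsum n \<phi> q) < d * real n"
    unfolding rank_null_def by blast
  show ?thesis
    unfolding rank_null_def
  proof (intro exI[of _ "F \<union> F'"] conjI allI impI)
    fix d :: real assume "0 < d"
    then have d: "0 < d / 2" by simp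
    obtain e where e: "0 < e" "\<And>n \<phi>. arep n F e \<phi> \<Longrightarrow> frank (gsum n \<phi> p) < d / 2 * real n"
      using F(2)[OF d] by blast
    obtain e' where e': "0 < e'" "\<And>n \<phi>. arep n F' e' \<phi> \<Longrightarrow> frank (gsum n \<phi> q) < d / 2 * real n"
      using F'(2)[OF d] by blast
    show "\<exists>e>0. \<forall>n \<phi>. arep n (F \<union> F') e \<phi> \<longrightarrow> frank (gsum n \<phi> (p + q)) < d * real n"
    proof (intro exI[of _ "min e e'"] conjI allI impI)
      fix n \<phi> assume \<phi>: "arep n (F \<union> F') (min e e') \<phi>"
      have 1: "frank (gsum n \<phi> p) < d / 2 * real n" by (rule e(2)[OF arep_mono[OF \<phi>]]) auto
      have 2: "frank (gsum n \<phi> q) < d / 2 * real n" by (rule e'(2)[OF arep_mono[OF \<phi>]]) auto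
      have "frank (gsum n \<phi> (p + q)) \<le> frank (gsum n \<phi> p) + frank (gsum n \<phi> q)"
        unfolding gsum_add[OF arepD(2)[OF \<phi>]] by (intro frank_add) simp_all
      with 1 2 show "frank (gsum n \<phi> (p + q)) < d * real n" by linarith
    qed (use e(1) e'(1) in simp)
  qed (use F F' in simp)
qed

lemma rank_null_scale:
  assumes "rank_null p"
  shows "rank_null (cg_scale c p)"
proof -
  have *: "frank (gsum n \<phi> (cg_scale c p)) \<le> frank (gsum n \<phi> p)" if "arep n F e \<phi>" for n F e \<phi>
    unfolding gsum_scale[OF arepD(2)[OF that]] by (rule frank_smult_le)
  have "real (frank (gsum n \<phi> (cg_scale c p))) < x" if "arep n F e \<phi>" "real (frank (gsum n \<phi> p)) < x" for n F e \<phi> x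
    using *[OF that(1)] that(2) by linarith
  with assms show ?thesis unfolding rank_null_def by meson
qed

text \<open>Once \<open>F'\<close> is tested with error at most \<open>e'\<close>, the null summand
  takes away less than \<open>d / 2\<close> of the relative rank. Both \<open>F'\<close> and
  \<open>e'\<close> depend on \<open>d\<close> only, so the remaining \<open>d / 2\<close> is again
  uniform.\<close>

lemma good_add_rank_null:
  assumes "good {p}" "rank_null q"
  shows "good {p + q}"
proof -
  from assms(1) obtain d where d: "0 < d" and ex: "\<And>F e. finite F \<Longrightarrow> 0 < e \<Longrightarrow>
     \<exists>n \<phi>. arep n F e \<phi> \<and> d * real n \<le> frank (gsum n \<phi> p)"
    unfolding good_def by auto
  from assms(2) d obtain F' e' where F': "finite F'" and e': "0 < e'"
    and q: "\<And>n \<phi>. arep n F' e' \<phi> \<Longrightarrow> frank (gsum n \<phi> q) < d / 2 * real n"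
    unfolding rank_null_def by (meson half_gt_zero)
  show ?thesis
    unfolding good_def
  proof (intro exI[of _ "d / 2"] conjI allI impI)
    fix F :: "'a set" and e :: real
    assume F: "finite F" and e: "0 < e"
    from ex[of "F \<union> F'" "min e e'"] F F' e e' obtain n \<phi> where
      \<phi>: "arep n (F \<union> F') (min e e') \<phi>" and p: "d * real n \<le> frank (gsum n \<phi> p)" by auto
    have 2: "frank (gsum n \<phi> q) < d / 2 * real n" by (rule q[OF arep_mono[OF \<phi>]]) auto
    have "gsum n \<phi> (p + q) - gsum n \<phi> q = gsum n \<phi> p"
      unfolding gsum_add[OF arepD(2)[OF \<phi>]] by (rule eq_matI) simp_all
    then have "frank (gsum n \<phi> p) \<le> frank (gsum n \<phi> (p + q)) + frank (gsum n \<phi> q)"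
      using frank_minus[of "gsum n \<phi> (p + q)" "gsum n \<phi> q"] by simp
    with p 2 have "d / 2 * real n \<le> frank (gsum n \<phi> (p + q))" by simp
    moreover have "arep n F e \<phi>" by (rule arep_mono[OF \<phi>]) auto
    ultimately show "\<exists>n \<phi>. arep n F e \<phi> \<and> (\<forall>a\<in>{p + q}. d / 2 * real n \<le> frank (gsum n \<phi> a))" by blast
  qed (use d in simp)
qed

theorem rank_null_if_not_good: "\<not> good {p} \<Longrightarrow> rank_null p"
proof (induction "card (keys p)" arbitrary: p rule: less_induct)
  case less
  show ?case
  proof (cases "p = 0")
    case True
    then show ?thesis by (simp add: rank_null_zero)
  next
    case False
    then obtain g where g: "g \<in> keys p" by fastforce
    have "\<exists>h\<in>keys p - {g}. rank_null (Poly_Mapping.single g 1 - Poly_Mapping.single h 1)"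
    proof (rule ccontr)
      assume "\<not> ?thesis"
      then have "good {a. keys a \<subseteq> insert g (keys p - {g}) \<and> lookup a g \<noteq> 0}"
        by (intro good_if_sep) (auto intro: sep_if_not_rank_null)
      then have "good {p}" by (rule good_subset) (use g in \<open>auto simp: in_keys_iff\<close>)
      with less.prems show False by simp
    qed
    then obtain h where h: "h \<in> keys p" "h \<noteq> g"
      and null: "rank_null (Poly_Mapping.single g 1 - Poly_Mapping.single h 1)" by auto
    \<comment> \<open>Subtracting \<open>q\<close> shifts the coefficient of \<open>p\<close> at
      \<open>g\<close> onto \<open>h\<close>, which already lies in the support, so \<open>g\<close>
      leaves and nothing enters.\<close>
    define q where "q = cg_scale (lookup p g) (Poly_Mapping.single g 1 - Poly_Mapping.single h 1)"
    have q: "rank_null q" unfolding q_def by (rule rank_null_scale[OF null])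
    have lq: "lookup q x = (if x = g then lookup p g else if x = h then - lookup p g else 0)" for x
      using h by (auto simp: q_def lookup_cg_scale lookup_minus lookup_single when_def)
    have "keys (p - q) \<subset> keys p"
    proof
      show "keys (p - q) \<subseteq> keys p"
        using g h by (auto simp: in_keys_iff lookup_minus lq split: if_splits)
      have "g \<notin> keys (p - q)" by (simp add: in_keys_iff lookup_minus lq)
      with g show "keys (p - q) \<noteq> keys p" by blast
    qed
    then have "card (keys (p - q)) < card (keys p)" by (intro psubset_card_mono) auto
    moreover have "\<not> good {p - q}"
      using good_add_rank_null[of "p - q" q] q less.prems by auto
    ultimately have "rank_null (p - q)" by (rule less.hyps)
    from rank_null_add[OF this q] show ?thesis by simp
  qed
qed

section \<open>Subspaces as column spaces\<close>

lemma col_eq_mult_unit_vec: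
  fixes K :: "'a::semiring_1 mat"
  assumes "K \<in> carrier_mat n w" "j < w"
  shows "col K j = K *\<^sub>v unit_vec w j"
  using assms carrier_matD[OF assms(1)] by (intro eq_vecI) simp_all

context vec_space
begin

text \<open>A maximal independent subset of \<open>W\<close> exists because independent sets in the
  ambient space have at most \<open>n\<close> elements. Span and independence mean the same inside
  \<open>W\<close> as outside, so it is a basis of \<open>W\<close>.\<close>

lemma subspace_basis:
  assumes "subspace class_ring W V"
  obtains bs where "distinct bs" "set bs \<subseteq> carrier_vec n" "lin_indpt (set bs)" "span (set bs) = W"
    "vectorspace.dim class_ring (vs W) = length bs"
proof -
  have sub: "submodule class_ring W V" using assms by (simp add: subspace_def)
  then have W: "W \<subseteq> carrier_vec n" unfolding submodule_def by simp
  have "\<exists>B. finite B \<and> maximal B (\<lambda>S. S \<subseteq> W \<and> lin_indpt S)"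
  proof (rule maximal_exists[where B = "{}" and N = n])
    fix A assume A: "A \<subseteq> W \<and> lin_indpt A"
    then have "A \<subseteq> carrier V" using W by auto
    with A show "finite A \<and> card A \<le> n" using li_le_dim[OF fin_dim] dim_is_n by auto
  next
    show "{} \<subseteq> W \<and> lin_indpt {}" by (auto simp: lin_dep_def)
  qed
  then obtain B where B: "finite B" and max: "maximal B (\<lambda>S. S \<subseteq> W \<and> lin_indpt S)" by blast
  have BW: "B \<subseteq> W" "lin_indpt B" using max by (auto simp: maximal_def)
  have "(\<lambda>S. S \<subseteq> W \<and> lin_indpt S) =
    (\<lambda>S. S \<subseteq> carrier (vs W) \<and> \<not> LinearCombinations.module.lin_dep class_ring (vs W) S)"
    using span_li_not_depend(2)[OF _ sub] by (auto simp: fun_eq_iff)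
  with max have "maximal B (\<lambda>S. S \<subseteq> carrier (vs W) \<and> \<not> LinearCombinations.module.lin_dep class_ring (vs W) S)"
    by simp
  then have basis: "vectorspace.basis class_ring (vs W) B"
    by (rule vectorspace.max_li_is_basis[OF subspace_is_vs[OF assms]])
  then have "LinearCombinations.module.span class_ring (vs W) B = W"
    by (simp add: vectorspace.basis_def[OF subspace_is_vs[OF assms]])
  then have span: "span B = W" using span_li_not_depend(1)[OF BW(1) sub] by simp
  have dim: "vectorspace.dim class_ring (vs W) = card B"
    by (rule vectorspace.dim_basis[OF subspace_is_vs[OF assms] B basis])
  obtain bs where "set bs = B" "distinct bs" using finite_distinct_list[OF B] by blast
  with BW W span dim that[of bs] show thesis by (auto simp: distinct_card)
qed

text \<open>The basis vectors are taken as columns. If \<open>frank K\<close> were smaller than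
  their number, a right annihilator of \<open>K\<close> would be nonzero, and one of its columns
  would be a linear dependency of the basis.\<close>

lemma subspace_matrix:
  assumes "subspace class_ring W V"
  obtains K where "K \<in> carrier_mat n (vectorspace.dim class_ring (vs W))"
    "frank K = vectorspace.dim class_ring (vs W)"
    "W = {K *\<^sub>v c | c. c \<in> carrier_vec (vectorspace.dim class_ring (vs W))}"
proof -
  obtain bs where bs: "distinct bs" "set bs \<subseteq> carrier_vec n" "lin_indpt (set bs)" "span (set bs) = W"
    and dim: "vectorspace.dim class_ring (vs W) = length bs"
    using subspace_basis[OF assms] by metis
  let ?w = "length bs"
  define K where "K = mat_of_cols n bs"
  have K: "K \<in> carrier_mat n ?w" by (simp add: K_def)
  have cols: "cols K = bs" unfolding K_def using bs(2) by (intro cols_mat_of_cols)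
  have dist: "distinct (cols K)" using bs(1) cols by simp
  have fK: "frank K = ?w"
  proof (rule ccontr)
    assume "frank K \<noteq> ?w"
    then have less: "frank K < ?w" using frank_le_dim_col[of K] K by simp
    obtain L where L: "L \<in> carrier_mat ?w ?w" and KL: "K * L = 0\<^sub>m n ?w"
      and rL: "\<And>Z. dim_col Z = ?w \<Longrightarrow> frank Z \<le> frank (Z * L) + frank K"
      using right_annihilator[of K] carrier_matD[OF K] by metis
    have "?w \<le> frank L + frank K" using rL[of "1\<^sub>m ?w"] L by simp
    with less have "0 < frank L" by simp
    then obtain i j where ij: "i < ?w" "j < ?w" "L $$ (i,j) \<noteq> 0"
      using exists_nonzero_entry[of L] carrier_matD[OF L] by metis
    have "K *\<^sub>v col L j = col (K * L) j" by (rule col_mult2[OF K L ij(2), symmetric])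
    also have "\<dots> = 0\<^sub>v n" unfolding KL using ij by simp
    finally have "K *\<^sub>v col L j = 0\<^sub>v n" .
    moreover have "col L j \<noteq> 0\<^sub>v ?w"
    proof
      assume "col L j = 0\<^sub>v ?w"
      then have "col L j $ i = 0" using ij by simp
      then show False using ij L by simp
    qed
    moreover have "col L j \<in> carrier_vec ?w" using ij L by simp
    ultimately have "lin_dep (set (cols K))" by (intro lin_depI[OF K _ _ _ dist])
    then show False using bs(3) cols by simp
  qed
  have WK: "W = {K *\<^sub>v c | c. c \<in> carrier_vec ?w}"
  proof -
    have "W = {lincomb a (set bs) | a. a \<in> set bs \<rightarrow> UNIV}"
      using finite_span[of "set bs"] bs(2,4) by simp
    also have "\<dots> = {K *\<^sub>v c | c. c \<in> carrier_vec ?w}"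
    proof (intro equalityI subsetI)
      fix x assume "x \<in> {lincomb a (set bs) | a. a \<in> set bs \<rightarrow> UNIV}"
      then obtain a where "x = lincomb a (set bs)" by blast
      then have "x = K *\<^sub>v vec ?w (\<lambda>i. a (col K i))"
        using mat_mult_eq_lincomb[OF K dist, of a] cols by simp
      then show "x \<in> {K *\<^sub>v c | c. c \<in> carrier_vec ?w}" by auto
    next
      fix x assume "x \<in> {K *\<^sub>v c | c. c \<in> carrier_vec ?w}"
      then obtain c where "c \<in> carrier_vec ?w" "x = K *\<^sub>v c" by blast
      then have "x = lincomb (\<lambda>a. c $ find_first a (cols K)) (set bs)"
        using lincomb_eq_mat_mult[OF K _ dist, of c] cols by simp
      then show "x \<in> {lincomb a (set bs) | a. a \<in> set bs \<rightarrow> UNIV}" by auto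
    qed
    finally show ?thesis .
  qed
  show thesis by (rule that[unfolded dim, OF K fK WK])
qed

lemma subspace_kernel:
  assumes "\<And>A. A \<in> S \<Longrightarrow> A \<in> carrier_mat m n"
  shows "subspace class_ring {v \<in> carrier_vec n. \<forall>A\<in>S. A *\<^sub>v v = 0\<^sub>v m} V"
proof -
  have zero: "A *\<^sub>v 0\<^sub>v n = 0\<^sub>v m" if "A \<in> S" for A
    using carrier_matD[OF assms[OF that]] by (intro eq_vecI) (simp_all add: scalar_prod_def)
  have "submodule class_ring {v \<in> carrier_vec n. \<forall>A\<in>S. A *\<^sub>v v = 0\<^sub>v m} V"
  proof (rule submodule.intro)
    show "Module.module class_ring V" by (rule vec_module)
    fix v w assume "v \<in> {v \<in> carrier_vec n. \<forall>A\<in>S. A *\<^sub>v v = 0\<^sub>v m}" "w \<in> {v \<in> carrier_vec n. \<forall>A\<in>S. A *\<^sub>v v = 0\<^sub>v m}"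
    then show "v \<oplus>\<^bsub>V\<^esub> w \<in> {v \<in> carrier_vec n. \<forall>A\<in>S. A *\<^sub>v v = 0\<^sub>v m}"
      using mult_add_distrib_mat_vec[OF assms] by (auto simp: module_vec_simps)
  next
    show "\<zero>\<^bsub>V\<^esub> \<in> {v \<in> carrier_vec n. \<forall>A\<in>S. A *\<^sub>v v = 0\<^sub>v m}"
      using zero by (auto simp: module_vec_simps)
  next
    fix c :: 'a and v assume "c \<in> carrier class_ring" "v \<in> {v \<in> carrier_vec n. \<forall>A\<in>S. A *\<^sub>v v = 0\<^sub>v m}"
    then show "c \<odot>\<^bsub>V\<^esub> v \<in> {v \<in> carrier_vec n. \<forall>A\<in>S. A *\<^sub>v v = 0\<^sub>v m}"
      using mult_mat_vec[OF assms] by (auto simp: module_vec_simps)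
  qed (auto simp: module_vec_simps)
  then show ?thesis using vec_vs by (simp add: subspace_def)
qed

text \<open>Expressing each column of \<open>M\<close> through the columns of \<open>K\<close>
  amounts to a factorization \<open>M = K * C\<close>.\<close>

lemma factor_through_subspace:
  assumes "K \<in> carrier_mat n w" "W = {K *\<^sub>v c | c. c \<in> carrier_vec w}"
    and "M \<in> carrier_mat n m" "\<And>j. j < m \<Longrightarrow> col M j \<in> W"
  shows "frank M \<le> frank K"
proof -
  have "\<forall>j. \<exists>c. j < m \<longrightarrow> c \<in> carrier_vec w \<and> col M j = K *\<^sub>v c" using assms(2,4) by blast
  then obtain c where c: "\<And>j. j < m \<Longrightarrow> c j \<in> carrier_vec w" "\<And>j. j < m \<Longrightarrow> col M j = K *\<^sub>v c j" by metis
  note d = carrier_matD[OF assms(1)] carrier_matD[OF assms(3)]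
  define C where "C = mat w m (\<lambda>(i,j). c j $ i)"
  have "M = K * C"
  proof (rule eq_matI)
    fix i j assume "i < dim_row (K * C)" "j < dim_col (K * C)"
    then have i: "i < n" and j: "j < m" using d by (auto simp: C_def)
    have "col C j = c j" using c(1)[OF j] j by (intro eq_vecI) (auto simp: C_def)
    have "M $$ (i,j) = col M j $ i" using i j d by simp
    also have "\<dots> = (K *\<^sub>v col C j) $ i" using c(2)[OF j] \<open>col C j = c j\<close> by simp
    also have "\<dots> = (K * C) $$ (i,j)" using i j d by (simp add: C_def)
    finally show "M $$ (i,j) = (K * C) $$ (i,j)" .
  qed (use d in \<open>simp_all add: C_def\<close>)
  then show ?thesis using frank_mult_le1[of K C] d by (simp add: C_def)
qed

text \<open>Let \<open>K\<close> have the span of the columns of \<open>M\<close> as its column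
  space. \<open>M\<close> factors through \<open>K\<close>, which gives one inequality. For the
  other, the left annihilator of \<open>M\<close> kills the whole span, hence \<open>K\<close>, so
  the rank of \<open>K\<close> is at most \<open>frank M\<close>.\<close>

lemma rank_eq_frank:
  assumes M: "M \<in> carrier_mat n m"
  shows "rank M = frank M"
proof -
  let ?W = "span (set (cols M))"
  have cM: "set (cols M) \<subseteq> carrier_vec n" using cols_dim[of M] M by simp
  have sW: "subspace class_ring ?W V" using span_is_subspace[of "set (cols M)"] cM by simp
  obtain K where K: "K \<in> carrier_mat n (rank M)" and rK: "frank K = rank M"
    and W: "?W = {K *\<^sub>v c | c. c \<in> carrier_vec (rank M)}"
    by (rule subspace_matrix[OF sW, folded rank_def[of M]])
  have "frank M \<le> rank M"
    unfolding rK[symmetric]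
  proof (rule factor_through_subspace[OF K W M])
    fix j assume "j < m"
    then have "col M j \<in> set (cols M)" using M by (metis carrier_matD(2) cols_length cols_nth nth_mem)
    then show "col M j \<in> ?W" using in_own_span[of "set (cols M)"] cM by auto
  qed
  moreover have "rank M \<le> frank M"
  proof -
    obtain Q where Q: "Q \<in> carrier_mat n n" and QM: "Q * M = 0\<^sub>m n m"
      and rQ: "\<And>Z. dim_row Z = n \<Longrightarrow> frank Z \<le> frank (Q * Z) + frank M"
      using left_annihilator[of M] carrier_matD[OF M] by metis
    let ?N = "{v \<in> carrier_vec n. \<forall>A\<in>{Q}. A *\<^sub>v v = 0\<^sub>v n}"
    have "set (cols M) \<subseteq> ?N"
    proof
      fix x assume "x \<in> set (cols M)"
      then obtain j where j: "j < m" "x = col M j" using M by (auto simp: cols_def)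
      have "Q *\<^sub>v col M j = col (Q * M) j" by (rule col_mult2[OF Q M j(1), symmetric])
      also have "\<dots> = 0\<^sub>v n" unfolding QM using j by simp
      finally show "x \<in> ?N" using j M by auto
    qed
    moreover have "submodule class_ring ?N V"
      using subspace_kernel[of "{Q}" n] Q unfolding subspace_def by blast
    ultimately have "?W \<subseteq> ?N" by (rule span_is_subset)
    have "Q * K = 0\<^sub>m n (rank M)"
    proof (rule eq_matI)
      fix i j assume "i < dim_row (0\<^sub>m n (rank M) :: 'a mat)" "j < dim_col (0\<^sub>m n (rank M) :: 'a mat)"
      then have ij: "i < n" "j < rank M" by auto
      have "col K j = K *\<^sub>v unit_vec (rank M) j" by (rule col_eq_mult_unit_vec[OF K ij(2)])
      then have "col K j \<in> ?W" unfolding W using unit_vec_carrier by blast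
      then have "col K j \<in> ?N" using \<open>?W \<subseteq> ?N\<close> by blast
      then have "(Q *\<^sub>v col K j) $ i = 0" using ij by simp
      then show "(Q * K) $$ (i,j) = 0\<^sub>m n (rank M) $$ (i,j)" using ij K Q by simp
    qed (use K Q in auto)
    then show ?thesis using rQ[of K] carrier_matD[OF K] rK by simp
  qed
  ultimately show ?thesis by simp
qed

end

text \<open>Right annihilators are composed one after the other, and each costs at most the rank of
  one \<open>A s\<close>. The columns of \<open>K\<close> lie in the joint kernel, so
  \<open>frank K\<close> bounds its dimension from below.\<close>

lemma joint_kernel_matrix:
  fixes A :: "'i \<Rightarrow> 'a::field mat"
  assumes "finite S" "\<And>s. s \<in> S \<Longrightarrow> A s \<in> carrier_mat n n"
  obtains K where "K \<in> carrier_mat n n" "n \<le> frank K + (\<Sum>s\<in>S. frank (A s))"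
    "\<And>s. s \<in> S \<Longrightarrow> A s * K = 0\<^sub>m n n"
proof -
  have "\<exists>K. K \<in> carrier_mat n n \<and> n \<le> frank K + (\<Sum>s\<in>S. frank (A s)) \<and> (\<forall>s\<in>S. A s * K = 0\<^sub>m n n)"
    using assms
  proof (induction S)
    case empty
    show ?case by (intro exI[of _ "1\<^sub>m n"]) simp
  next
    case (insert s S)
    then obtain K where K: "K \<in> carrier_mat n n" "n \<le> frank K + (\<Sum>s\<in>S. frank (A s))"
      "\<forall>s\<in>S. A s * K = 0\<^sub>m n n" by auto
    have As: "A s \<in> carrier_mat n n" using insert.prems by simp
    note d = carrier_matD[OF K(1)] carrier_matD[OF As]
    obtain L where L: "L \<in> carrier_mat n n" and AL: "(A s * K) * L = 0\<^sub>m n n"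
      and rL: "\<And>Z. dim_col Z = n \<Longrightarrow> frank Z \<le> frank (Z * L) + frank (A s * K)"
      using right_annihilator[of "A s * K"] d by (metis index_mult_mat(2,3))
    note d = d carrier_matD[OF L]
    have "frank (A s * K) \<le> frank (A s)" using d by (intro frank_mult_le1) simp
    then have "n \<le> frank (K * L) + (\<Sum>s\<in>insert s S. frank (A s))"
      using K(2) rL[of K] d insert.hyps by simp
    moreover have "A t * (K * L) = 0\<^sub>m n n" if t: "t \<in> insert s S" for t
    proof (cases "t = s")
      case True
      then show ?thesis using AL d by (simp add: mat_assoc)
    next
      case False
      then have "A t * K = 0\<^sub>m n n" using K(3) t by simp
      moreover have "dim_col (A t) = n" using insert.prems[OF t] by simp
      ultimately show ?thesis using mat_assoc[of "A t" K L] d by (simp add: mat_zero_mult)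
    qed
    moreover have "K * L \<in> carrier_mat n n" using K(1) L by simp
    ultimately show ?case by blast
  qed
  with that show thesis by blast
qed

section \<open>Almost representations of the group algebra\<close>

lemma cg_scale_single: "cg_scale c (Poly_Mapping.single g x) = Poly_Mapping.single g (c * x)"
  by (rule poly_mapping_eqI) (simp add: lookup_cg_scale lookup_single when_def)

lemma module_cg_scale: "Modules.module (cg_scale :: complex \<Rightarrow> ('g::group_add \<Rightarrow>\<^sub>0 complex) \<Rightarrow> _)"
  by (unfold_locales; rule poly_mapping_eqI; simp add: lookup_cg_scale lookup_add algebra_simps)

lemma sum_monomials:
  fixes a :: "'g::group_add \<Rightarrow>\<^sub>0 complex"
  assumes "finite S" "keys a \<subseteq> S"
  shows "a = (\<Sum>g\<in>S. Poly_Mapping.single g (lookup a g))"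
proof (rule poly_mapping_eqI)
  fix k
  show "lookup a k = lookup (\<Sum>g\<in>S. Poly_Mapping.single g (lookup a g)) k"
    using assms by (cases "k \<in> S") (auto simp: Poly_Mapping.lookup_sum lookup_single when_def in_keys_iff subset_iff)
qed

lemma subspace_keys: "Modules.module.subspace cg_scale {a :: 'g::group_add \<Rightarrow>\<^sub>0 complex. keys a \<subseteq> S}"
  unfolding Modules.module.subspace_def[OF module_cg_scale]
proof (intro conjI ballI allI)
  fix a b :: "'g \<Rightarrow>\<^sub>0 complex" assume "a \<in> {a. keys a \<subseteq> S}" "b \<in> {a. keys a \<subseteq> S}"
  then show "a + b \<in> {a. keys a \<subseteq> S}" using Poly_Mapping.keys_add[of a b] by auto
next
  fix c and a :: "'g \<Rightarrow>\<^sub>0 complex" assume "a \<in> {a. keys a \<subseteq> S}"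
  then show "cg_scale c a \<in> {a. keys a \<subseteq> S}" by (auto simp: in_keys_iff lookup_cg_scale subset_iff)
qed simp

lemma fd_subspace_keys:
  assumes "finite S"
  shows "fd_subspace cg_scale {a :: 'g::group_add \<Rightarrow>\<^sub>0 complex. keys a \<subseteq> S}"
  unfolding fd_subspace_def
proof (intro conjI exI[of _ "(\<lambda>g. Poly_Mapping.single g 1) ` S"])
  let ?B = "(\<lambda>g. Poly_Mapping.single g (1::complex)) ` S"
  note mod = module_cg_scale[where 'g = 'g]
  show "Modules.module.span cg_scale ?B = {a. keys a \<subseteq> S}"
  proof
    show "Modules.module.span cg_scale ?B \<subseteq> {a. keys a \<subseteq> S}"
      by (rule Modules.module.span_minimal[OF mod _ subspace_keys]) (auto split: if_splits)
    show "{a. keys a \<subseteq> S} \<subseteq> Modules.module.span cg_scale ?B"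
    proof
      fix a :: "'g \<Rightarrow>\<^sub>0 complex" assume "a \<in> {a. keys a \<subseteq> S}"
      then have "a = (\<Sum>g\<in>S. cg_scale (lookup a g) (Poly_Mapping.single g 1))"
        using sum_monomials[OF assms, of a] by (simp add: cg_scale_single)
      also have "\<dots> \<in> Modules.module.span cg_scale ?B"
        by (intro Modules.module.span_sum[OF mod] Modules.module.span_scale[OF mod] Modules.module.span_base[OF mod]) simp
      finally show "a \<in> Modules.module.span cg_scale ?B" .
    qed
  qed
qed (simp_all add: subspace_keys assms)

text \<open>The supports of finitely many generators cover the support of every combination. Thus
  each \<open>L\<close> comes with a finite set of group elements to test.\<close>

lemma fd_subspace_keys_bound:
  assumes "fd_subspace cg_scale (L :: ('g::group_add \<Rightarrow>\<^sub>0 complex) set)"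
  obtains F where "finite F" "\<And>a. a \<in> L \<Longrightarrow> keys a \<subseteq> F"
proof -
  from assms obtain B where B: "finite B" "Modules.module.span cg_scale B = L"
    unfolding fd_subspace_def by blast
  let ?F = "\<Union>b\<in>B. keys b"
  have "Modules.module.span cg_scale B \<subseteq> {a. keys a \<subseteq> ?F}"
    by (rule Modules.module.span_minimal[OF module_cg_scale _ subspace_keys]) auto
  with B that[of ?F] show thesis by auto
qed

lemma gsum_mult_vec:
  assumes "\<And>g. \<phi> g \<in> carrier_mat n n" "finite S" "keys a \<subseteq> S" "v \<in> carrier_vec n" "i < n"
  shows "(gsum n \<phi> a *\<^sub>v v) $ i = (\<Sum>g\<in>S. lookup a g * (\<phi> g *\<^sub>v v) $ i)"
proof -
  note d = carrier_matD[OF assms(1)]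
  have "(gsum n \<phi> a *\<^sub>v v) $ i = (\<Sum>l = 0..<n. \<Sum>g\<in>S. lookup a g * \<phi> g $$ (i,l) * v $ l)"
    using assms(4,5) by (simp add: scalar_prod_def index_gsum[OF assms(1-3)] sum_distrib_right)
  also have "\<dots> = (\<Sum>g\<in>S. \<Sum>l = 0..<n. lookup a g * \<phi> g $$ (i,l) * v $ l)" by (rule sum.swap)
  also have "\<dots> = (\<Sum>g\<in>S. lookup a g * (\<phi> g *\<^sub>v v) $ i)"
    using assms(4,5) d by (simp add: scalar_prod_def sum_distrib_left mult.assoc)
  finally show ?thesis .
qed

lemma mult_gsum_vec:
  assumes "\<And>g. \<phi> g \<in> carrier_mat n n" "finite S" "keys a \<subseteq> S" "v \<in> carrier_vec n" "i < n"
    and A: "A \<in> carrier_mat n n"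
  shows "(A *\<^sub>v (gsum n \<phi> a *\<^sub>v v)) $ i = (\<Sum>g\<in>S. lookup a g * (A *\<^sub>v (\<phi> g *\<^sub>v v)) $ i)"
proof -
  note d = carrier_matD[OF assms(1)] carrier_matD[OF A]
  have "(A *\<^sub>v (gsum n \<phi> a *\<^sub>v v)) $ i = (\<Sum>l = 0..<n. A $$ (i,l) * (gsum n \<phi> a *\<^sub>v v) $ l)"
    using assms(5) d by (simp add: scalar_prod_def)
  also have "\<dots> = (\<Sum>l = 0..<n. \<Sum>g\<in>S. lookup a g * (A $$ (i,l) * (\<phi> g *\<^sub>v v) $ l))"
    by (intro sum.cong refl)
      (simp add: gsum_mult_vec[OF assms(1-4)] sum_distrib_left mult.left_commute del: index_mult_mat_vec)
  also have "\<dots> = (\<Sum>g\<in>S. \<Sum>l = 0..<n. lookup a g * (A $$ (i,l) * (\<phi> g *\<^sub>v v) $ l))" by (rule sum.swap)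
  also have "\<dots> = (\<Sum>g\<in>S. lookup a g * (A *\<^sub>v (\<phi> g *\<^sub>v v)) $ i)"
    using assms(5) d by (simp add: scalar_prod_def sum_distrib_left)
  finally show ?thesis .
qed

lemma index_gsum_sum:
  assumes "\<And>g. \<phi> g \<in> carrier_mat n n" "i < n" "j < n"
  shows "gsum n \<phi> (\<Sum>s\<in>S. f s) $$ (i,j) = (\<Sum>s\<in>S. gsum n \<phi> (f s) $$ (i,j))"
  using assms(2,3)
  by (induction S rule: infinite_finite_induct) (simp_all add: gsum_zero gsum_add[OF assms(1)])

lemma index_gsum_mult:
  fixes a b :: "'g::group_add \<Rightarrow>\<^sub>0 complex"
  assumes "\<And>g. \<phi> g \<in> carrier_mat n n" "finite S" "keys a \<subseteq> S" "keys b \<subseteq> S" "i < n" "j < n"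
  shows "gsum n \<phi> (a * b) $$ (i,j) =
    (\<Sum>g\<in>S. \<Sum>h\<in>S. lookup a g * (lookup b h * \<phi> (g + h) $$ (i,j)))"
proof -
  have "a * b = (\<Sum>g\<in>S. Poly_Mapping.single g (lookup a g)) * (\<Sum>h\<in>S. Poly_Mapping.single h (lookup b h))"
    using sum_monomials[OF assms(2,3)] sum_monomials[OF assms(2,4)] by simp
  also have "\<dots> = (\<Sum>g\<in>S. \<Sum>h\<in>S. Poly_Mapping.single (g + h) (lookup a g * lookup b h))"
    by (simp add: sum_product mult_single)
  finally have "a * b = (\<Sum>g\<in>S. \<Sum>h\<in>S. Poly_Mapping.single (g + h) (lookup a g * lookup b h))" .
  then show ?thesis
    using assms(5,6) carrier_matD[OF assms(1)]
    by (simp add: index_gsum_sum[OF assms(1)] gsum_single[OF assms(1)] mult.assoc)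
qed

text \<open>Both sides are bilinear in the coefficients of \<open>a\<close> and \<open>b\<close>, so
  correctness at \<open>v\<close> for pairs of group elements from \<open>S\<close> is
  enough.\<close>

lemma gsum_mult_vec_eq:
  fixes a b :: "'g::group_add \<Rightarrow>\<^sub>0 complex"
  assumes \<phi>: "\<And>g. \<phi> g \<in> carrier_mat n n" and S: "finite S" "keys a \<subseteq> S" "keys b \<subseteq> S"
    and v: "v \<in> carrier_vec n"
    and 0: "\<And>g h. g \<in> S \<Longrightarrow> h \<in> S \<Longrightarrow> (\<phi> g * \<phi> h - \<phi> (g + h)) *\<^sub>v v = 0\<^sub>v n"
  shows "gsum n \<phi> a *\<^sub>v (gsum n \<phi> b *\<^sub>v v) = gsum n \<phi> (a * b) *\<^sub>v v"
proof (rule eq_vecI)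
  note d = carrier_matD[OF \<phi>]
  fix i assume "i < dim_vec (gsum n \<phi> (a * b) *\<^sub>v v)"
  then have i: "i < n" by simp
  have eq: "(\<phi> g *\<^sub>v (\<phi> h *\<^sub>v v)) $ i = (\<phi> (g + h) *\<^sub>v v) $ i" if "g \<in> S" "h \<in> S" for g h
  proof -
    have "(\<phi> g * \<phi> h - \<phi> (g + h)) *\<^sub>v v = \<phi> g * \<phi> h *\<^sub>v v - \<phi> (g + h) *\<^sub>v v"
      by (rule minus_mult_distrib_mat_vec[OF mult_carrier_mat[OF \<phi> \<phi>] \<phi> v])
    then have "\<phi> g * \<phi> h *\<^sub>v v - \<phi> (g + h) *\<^sub>v v = 0\<^sub>v n" using 0[OF that] by simp
    then have "(\<phi> g * \<phi> h *\<^sub>v v - \<phi> (g + h) *\<^sub>v v) $ i = 0" using i by simp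
    then have "(\<phi> g * \<phi> h *\<^sub>v v) $ i = (\<phi> (g + h) *\<^sub>v v) $ i"
      using i d by (simp del: index_mult_mat_vec)
    moreover have "\<phi> g * \<phi> h *\<^sub>v v = \<phi> g *\<^sub>v (\<phi> h *\<^sub>v v)"
      by (rule assoc_mult_mat_vec[OF \<phi> \<phi> v])
    ultimately show ?thesis by simp
  qed
  have w: "gsum n \<phi> b *\<^sub>v v \<in> carrier_vec n" by (rule carrier_vecI) simp
  have "(gsum n \<phi> a *\<^sub>v (gsum n \<phi> b *\<^sub>v v)) $ i =
    (\<Sum>g\<in>S. lookup a g * (\<Sum>h\<in>S. lookup b h * (\<phi> g *\<^sub>v (\<phi> h *\<^sub>v v)) $ i))"
    unfolding gsum_mult_vec[OF \<phi> S(1,2) w i] mult_gsum_vec[OF \<phi> S(1,3) v i \<phi>] ..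
  also have "\<dots> = (\<Sum>g\<in>S. lookup a g * (\<Sum>h\<in>S. lookup b h * (\<phi> (g + h) *\<^sub>v v) $ i))"
    by (intro sum.cong refl arg_cong2[of _ _ _ _ "(*)"]) (simp add: eq)
  also have "\<dots> = (\<Sum>g\<in>S. \<Sum>h\<in>S. \<Sum>l = 0..<n. lookup a g * (lookup b h * \<phi> (g + h) $$ (i,l)) * v $ l)"
    using i v d by (simp add: scalar_prod_def sum_distrib_left mult.assoc)
  also have "\<dots> = (\<Sum>l = 0..<n. \<Sum>g\<in>S. \<Sum>h\<in>S. lookup a g * (lookup b h * \<phi> (g + h) $$ (i,l)) * v $ l)"
    by (subst sum.swap[of _ "{0..<n}"], subst sum.swap[of _ "{0..<n}"]) (rule refl)
  also have "\<dots> = (\<Sum>l = 0..<n. gsum n \<phi> (a * b) $$ (i,l) * v $ l)"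
    by (intro sum.cong refl) (simp add: index_gsum_mult[OF \<phi> S i] sum_distrib_right)
  also have "\<dots> = (gsum n \<phi> (a * b) *\<^sub>v v) $ i" using i v by (simp add: scalar_prod_def)
  finally show "(gsum n \<phi> a *\<^sub>v (gsum n \<phi> b *\<^sub>v v)) $ i = (gsum n \<phi> (a * b) *\<^sub>v v) $ i" .
qed simp

section \<open>Passing between almost representations of the group and of its algebra\<close>

text \<open>The subspace on which products are respected is the joint kernel of the
  \<open>card F * card F\<close> defects; its codimension is at most the sum of their ranks.\<close>

lemma almost_rep_gsum:
  fixes L :: "('g::group_add \<Rightarrow>\<^sub>0 complex) set" and e \<epsilon> :: real
  assumes L: "\<And>a. a \<in> L \<Longrightarrow> keys a \<subseteq> F" and F: "finite F"
    and \<phi>: "arep n F e \<phi>" and e: "real (card F * card F) * e < \<epsilon>"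
  shows "almost_rep cg_scale L \<epsilon> n (gsum n \<phi>)"
proof -
  note a = arepD[OF \<phi>]
  define E where "E = (\<lambda>(g,h). \<phi> g * \<phi> h - \<phi> (g + h))"
  let ?W = "{v \<in> carrier_vec n. \<forall>A\<in>E ` (F \<times> F). A *\<^sub>v v = 0\<^sub>v n}"
  have cE: "E x \<in> carrier_mat n n" for x using a(3,4) by (cases x) (auto simp: E_def intro!: carrier_matI)
  obtain K where K: "K \<in> carrier_mat n n" and rK: "n \<le> frank K + (\<Sum>x\<in>F \<times> F. frank (E x))"
    and EK: "\<And>x. x \<in> F \<times> F \<Longrightarrow> E x * K = 0\<^sub>m n n"
    using joint_kernel_matrix[of "F \<times> F" E n, OF finite_cartesian_product[OF F F] cE] by blast
  have sub: "subspace class_ring ?W (module_vec TYPE(complex) n)"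
    by (rule vec_space.subspace_kernel) (use cE in blast)
  let ?w = "cdim_sub n ?W"
  obtain B where B: "B \<in> carrier_mat n ?w" "frank B = ?w" "?W = {B *\<^sub>v c | c. c \<in> carrier_vec ?w}"
    by (rule vec_space.subspace_matrix[OF sub, folded cdim_sub_def])
  have "frank K \<le> ?w"
    unfolding B(2)[symmetric]
  proof (rule vec_space.factor_through_subspace[OF B(1,3) K])
    fix j assume j: "j < n"
    have "E x *\<^sub>v col K j = 0\<^sub>v n" if "x \<in> F \<times> F" for x
    proof -
      have "E x *\<^sub>v col K j = col (E x * K) j" by (rule col_mult2[OF cE K j, symmetric])
      then show ?thesis unfolding EK[OF that] using j by simp
    qed
    then show "col K j \<in> ?W" using j K by auto
  qed
  then have "real n \<le> ?w + (\<Sum>x\<in>F \<times> F. real (frank (E x)))"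
    unfolding of_nat_sum[symmetric] of_nat_add[symmetric] of_nat_le_iff using rK by linarith
  also have "(\<Sum>x\<in>F \<times> F. real (frank (E x))) \<le> (\<Sum>x\<in>F \<times> F. e * real n)"
    by (intro sum_mono) (use a(6) in \<open>auto simp: E_def\<close>)
  also have "\<dots> = real (card F * card F) * e * real n" by (simp add: card_cartesian_product)
  also have "real (card F * card F) * e * real n < \<epsilon> * real n" using e a(1) by (intro mult_strict_right_mono) auto
  finally have dim: "real n - real ?w < \<epsilon> * real n" by simp
  show ?thesis
    unfolding almost_rep_def
  proof (intro conjI ballI allI impI exI[of _ ?W])
    show "gsum n \<phi> x \<in> carrier_mat n n" for x by (intro carrier_matI) simp_all
    show "gsum n \<phi> (x + y) = gsum n \<phi> x + gsum n \<phi> y" for x y by (rule gsum_add[OF a(2)])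
    show "gsum n \<phi> (cg_scale c x) = c \<cdot>\<^sub>m gsum n \<phi> x" for c x by (rule gsum_scale[OF a(2)])
    show "gsum n \<phi> 1 = 1\<^sub>m n"
    proof -
      have "gsum n \<phi> (Poly_Mapping.single 0 1) = 1 \<cdot>\<^sub>m \<phi> 0" by (rule gsum_single[OF a(2)])
      moreover have "1 \<cdot>\<^sub>m \<phi> 0 = 1\<^sub>m n" unfolding a(5) by (intro eq_matI) simp_all
      ultimately show ?thesis by simp
    qed
    show "subspace class_ring ?W (module_vec TYPE(complex) n)" by (rule sub)
    show "real n - real ?w < \<epsilon> * real n" by (rule dim)
    fix x y v assume "x \<in> L" "y \<in> L" and v: "v \<in> ?W"
    then show "gsum n \<phi> x *\<^sub>v (gsum n \<phi> y *\<^sub>v v) = gsum n \<phi> (x * y) *\<^sub>v v"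
      by (intro gsum_mult_vec_eq[OF a(2) F L L]) (auto simp: E_def)
  qed
qed

lemma ran_dim_eq_frank: "M \<in> carrier_mat n m \<Longrightarrow> ran_dim n M = frank M"
  unfolding ran_dim_def by (rule vec_space.rank_eq_frank)

lemma not_good_if_sofic:
  fixes p :: "'g::group_add \<Rightarrow>\<^sub>0 complex"
  assumes afdr: "has_afdr (cg_scale :: complex \<Rightarrow> ('g \<Rightarrow>\<^sub>0 complex) \<Rightarrow> _)"
    and p: "p \<in> sofic_radical cg_scale"
  shows "\<not> good {p}"
proof
  assume "good {p}"
  then obtain d where d: "0 < d" and ex: "\<And>F e. finite F \<Longrightarrow> 0 < e \<Longrightarrow>
     \<exists>n \<phi>. arep n F e \<phi> \<and> d * real n \<le> frank (gsum n \<phi> p)"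
    unfolding good_def by auto
  from p afdr d obtain L \<eta> where L: "fd_subspace cg_scale L" and "0 < \<eta>"
    and small: "\<And>\<epsilon> n \<psi>. 0 < \<epsilon> \<Longrightarrow> \<epsilon> < \<eta> \<Longrightarrow> almost_rep cg_scale L \<epsilon> n \<psi> \<Longrightarrow> real (ran_dim n (\<psi> p)) < d * real n"
    unfolding sofic_radical_def by auto
  obtain F where F: "finite F" "\<And>a. a \<in> L \<Longrightarrow> keys a \<subseteq> F" using fd_subspace_keys_bound[OF L] by metis
  define c where "c = real (card F * card F)"
  \<comment> \<open>The summand \<open>1\<close> rules out a zero denominator and makes
    \<open>c * e < \<eta> / 2\<close> strict.\<close>
  define e where "e = \<eta> / 2 / (c + 1)"
  have c: "0 < c + 1" by (simp add: c_def add_nonneg_pos)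
  then have "0 < e" using \<open>0 < \<eta>\<close> by (simp add: e_def)
  then obtain n \<phi> where \<phi>: "arep n F e \<phi>" and big: "d * real n \<le> frank (gsum n \<phi> p)" using ex F(1) by blast
  have "(c + 1) * e = \<eta> / 2" using c by (simp only: e_def) (simp add: field_simps)
  then have "c * e < \<eta> / 2" using \<open>0 < e\<close> by (simp add: algebra_simps)
  then have "almost_rep cg_scale L (\<eta> / 2) n (gsum n \<phi>)" using almost_rep_gsum[OF F(2,1) \<phi>] by (simp only: c_def)
  then have "real (ran_dim n (gsum n \<phi> p)) < d * real n"
    using small[of "\<eta> / 2" n "gsum n \<phi>"] \<open>0 < \<eta>\<close> by simp
  moreover have "gsum n \<phi> p \<in> carrier_mat n n" by (intro carrier_matI) simp_all
  ultimately show False using big by (simp add: ran_dim_eq_frank)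
qed

text \<open>An almost representation of a suitable \<open>L\<close> restricts to monomials and gives
  an almost representation of the group for \<open>F\<close>. As \<open>F\<close> is fixed before
  \<open>d\<close>, so is \<open>L\<close>.\<close>

lemma rank_radical_if_rank_null:
  fixes p :: "'g::group_add \<Rightarrow>\<^sub>0 complex"
  assumes afdr: "has_afdr (cg_scale :: complex \<Rightarrow> ('g \<Rightarrow>\<^sub>0 complex) \<Rightarrow> _)" and p: "rank_null p"
  shows "p \<in> rank_radical cg_scale"
proof -
  from p obtain F where F: "finite F"
    and small: "\<And>d :: real. 0 < d \<Longrightarrow> \<exists>e>0. \<forall>n \<phi>. arep n F e \<phi> \<longrightarrow> frank (gsum n \<phi> p) < d * real n"
    unfolding rank_null_def by blast
  \<comment> \<open>The sums from \<open>F\<close> are included so that products of monomials over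
    \<open>F\<close> stay in \<open>L\<close>, where \<open>\<psi>\<close> is multiplicative on
    \<open>W\<close>. The support of \<open>p\<close> and \<open>0\<close> ensure that
    \<open>p\<close> and \<open>1\<close> lie in \<open>L\<close>.\<close>
  define S where "S = F \<union> (\<lambda>(g,h). g + h) ` (F \<times> F) \<union> keys p \<union> {0}"
  define L where "L = {a :: 'g \<Rightarrow>\<^sub>0 complex. keys a \<subseteq> S}"
  have S: "finite S" "0 \<in> S" "F \<subseteq> S" "keys p \<subseteq> S" "\<And>g h. g \<in> F \<Longrightarrow> h \<in> F \<Longrightarrow> g + h \<in> S"
    using F by (auto simp: S_def)
  have sub: "fd_subspace cg_scale L" unfolding L_def by (rule fd_subspace_keys[OF S(1)])
  have L: "1 \<in> L" "p \<in> L" using S by (auto simp: L_def)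
  have single_L: "Poly_Mapping.single g c \<in> L" if "g \<in> S" for g c using that by (auto simp: L_def)
  have main: "real (ran_dim n (\<psi> p)) < d * real n"
    if e: "0 < e" "\<And>n \<phi>. arep n F e \<phi> \<Longrightarrow> frank (gsum n \<phi> p) < d * real n"
      and \<epsilon>: "0 < \<epsilon>" "\<epsilon> < e" and rep: "almost_rep cg_scale L \<epsilon> n \<psi>" for d e \<epsilon> :: real and n \<psi>
  proof -
    from rep obtain W where car: "\<And>a. a \<in> L \<Longrightarrow> \<psi> a \<in> carrier_mat n n"
      and add: "\<And>a b. a \<in> L \<Longrightarrow> b \<in> L \<Longrightarrow> \<psi> (a + b) = \<psi> a + \<psi> b"
      and scale: "\<And>c a. a \<in> L \<Longrightarrow> \<psi> (cg_scale c a) = c \<cdot>\<^sub>m \<psi> a"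
      and one: "\<psi> 1 = 1\<^sub>m n"
      and W: "subspace class_ring W (module_vec TYPE(complex) n)"
      and dim: "real n - real (cdim_sub n W) < \<epsilon> * real n"
      and mult: "\<And>a b v. a \<in> L \<Longrightarrow> b \<in> L \<Longrightarrow> a * b \<in> L \<Longrightarrow> v \<in> W \<Longrightarrow> \<psi> a *\<^sub>v (\<psi> b *\<^sub>v v) = \<psi> (a * b) *\<^sub>v v"
      unfolding almost_rep_def by blast
    \<comment> \<open>Outside \<open>S\<close> the value is a placeholder: the conditions in
      \<open>arep\<close> on products and on \<open>0\<close>, and the image of \<open>p\<close>,
      only involve elements of \<open>S\<close>.\<close>
    define \<phi> where "\<phi> = (\<lambda>g. if g \<in> S then \<psi> (Poly_Mapping.single g 1) else 0\<^sub>m n n)"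
    have \<phi>: "\<phi> g \<in> carrier_mat n n" for g using car[OF single_L] by (simp add: \<phi>_def)
    let ?w = "cdim_sub n W"
    obtain B where B: "B \<in> carrier_mat n ?w" "frank B = ?w" "W = {B *\<^sub>v c | c. c \<in> carrier_vec ?w}"
      by (rule vec_space.subspace_matrix[OF W, folded cdim_sub_def])
    have "?w \<le> n" using frank_le_dim_row[of B] carrier_matD(1)[OF B(1)] B(2) by simp
    then have n: "0 < n" using dim by (cases n) auto
    have "arep n F e \<phi>"
      unfolding arep_def
    proof (intro conjI allI ballI)
      show "\<phi> 0 = 1\<^sub>m n" using S(2) one by (simp add: \<phi>_def)
      fix g h assume gh: "g \<in> F" "h \<in> F"
      let ?E = "\<phi> g * \<phi> h - \<phi> (g + h)"
      have cE: "?E \<in> carrier_mat n n" using \<phi> by (intro minus_carrier_mat)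
      have "?E * B = 0\<^sub>m n ?w"
      proof (rule eq_matI)
        fix i j assume "i < dim_row (0\<^sub>m n ?w :: complex mat)" "j < dim_col (0\<^sub>m n ?w :: complex mat)"
        then have ij: "i < n" "j < ?w" by auto
        have cB: "col B j \<in> carrier_vec n" using ij B(1) by simp
        have "col B j = B *\<^sub>v unit_vec ?w j" by (rule col_eq_mult_unit_vec[OF B(1) ij(2)])
        then have "col B j \<in> W" by (subst B(3)) (use unit_vec_carrier in \<open>blast\<close>)
        moreover have "g \<in> S" "h \<in> S" "g + h \<in> S" using gh S by auto
        ultimately have "\<phi> g *\<^sub>v (\<phi> h *\<^sub>v col B j) = \<phi> (g + h) *\<^sub>v col B j"
          using mult[of "Poly_Mapping.single g 1" "Poly_Mapping.single h 1" "col B j"] single_L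
          by (simp add: \<phi>_def mult_single)
        moreover have "\<phi> g * \<phi> h *\<^sub>v col B j = \<phi> g *\<^sub>v (\<phi> h *\<^sub>v col B j)"
          by (rule assoc_mult_mat_vec[OF \<phi> \<phi> cB])
        moreover have "?E *\<^sub>v col B j = \<phi> g * \<phi> h *\<^sub>v col B j - \<phi> (g + h) *\<^sub>v col B j"
          by (rule minus_mult_distrib_mat_vec[OF mult_carrier_mat[OF \<phi> \<phi>] \<phi> cB])
        ultimately have "?E *\<^sub>v col B j = \<phi> (g + h) *\<^sub>v col B j - \<phi> (g + h) *\<^sub>v col B j" by simp
        then have "(?E *\<^sub>v col B j) $ i = 0" using ij carrier_matD[OF \<phi>] by (simp del: index_mult_mat_vec)
        then show "(?E * B) $$ (i,j) = 0\<^sub>m n ?w $$ (i,j)"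
          using ij carrier_matD[OF B(1)] carrier_matD[OF \<phi>] by simp
      qed (use carrier_matD[OF B(1)] carrier_matD[OF \<phi>] in simp_all)
      \<comment> \<open>The defect vanishes on \<open>W\<close>, the column space of
        \<open>B\<close>, so Sylvester's inequality bounds its rank by the codimension of
        \<open>W\<close>.\<close>
      then have "frank ?E + frank B \<le> n"
        using sylvester[of ?E B] carrier_matD[OF B(1)] carrier_matD[OF cE] by simp
      then have "real (frank ?E) \<le> real n - real ?w" using B(2) by simp
      also have "\<dots> \<le> e * real n" using dim \<epsilon> mult_right_mono[of \<epsilon> e "real n"] by simp
      finally show "real (frank ?E) \<le> e * real n" .
    qed (use n \<phi> in auto)
    then have "frank (gsum n \<phi> p) < d * real n" by (rule e(2))
    moreover have "gsum n \<phi> p = \<psi> p"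
    proof -
      have zero: "0 \<in> L" by (simp add: L_def)
      \<comment> \<open>Homogeneity at the scalar \<open>0\<close> yields
        \<open>\<psi> 0 = 0\<close>, the base case for expanding \<open>\<psi> p\<close> over
        monomials.\<close>
      have "cg_scale 0 0 = (0 :: 'g \<Rightarrow>\<^sub>0 complex)" by (rule poly_mapping_eqI) (simp add: lookup_cg_scale)
      then have \<psi>: "\<psi> 0 = 0 \<cdot>\<^sub>m \<psi> 0" using scale[OF zero, of 0] by metis
      have \<psi>0: "\<psi> 0 $$ (i,j) = 0" if "i < n" "j < n" for i j
        using that carrier_matD[OF car[OF zero]] by (subst \<psi>) simp
      have sum: "(\<Sum>g\<in>T. Poly_Mapping.single g (lookup p g)) \<in> L \<and>
          (\<forall>i<n. \<forall>j<n. \<psi> (\<Sum>g\<in>T. Poly_Mapping.single g (lookup p g)) $$ (i,j) = (\<Sum>g\<in>T. lookup p g * \<phi> g $$ (i,j)))"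
        if "finite T" "T \<subseteq> S" for T
        using that
      proof (induction T)
        case empty
        then show ?case using zero \<psi>0 by simp
      next
        case (insert g T)
        let ?s = "\<Sum>g\<in>T. Poly_Mapping.single g (lookup p g)"
        have g: "g \<in> S" and IH: "?s \<in> L"
          "\<And>i j. i < n \<Longrightarrow> j < n \<Longrightarrow> \<psi> ?s $$ (i,j) = (\<Sum>g\<in>T. lookup p g * \<phi> g $$ (i,j))"
          using insert by auto
        have "\<psi> (Poly_Mapping.single g (lookup p g)) = lookup p g \<cdot>\<^sub>m \<phi> g"
          using scale[OF single_L[OF g], of "lookup p g" 1] g by (simp add: \<phi>_def cg_scale_single)
        then have eq: "\<psi> (Poly_Mapping.single g (lookup p g) + ?s) = lookup p g \<cdot>\<^sub>m \<phi> g + \<psi> ?s"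
          using add[OF single_L[OF g] IH(1)] by simp
        have "Poly_Mapping.single g (lookup p g) + ?s \<in> L"
          using single_L[OF g, of "lookup p g"] IH(1) Poly_Mapping.keys_add[of "Poly_Mapping.single g (lookup p g)" ?s]
          unfolding L_def by blast
        then show ?case
          using insert.hyps eq IH(2) carrier_matD[OF \<phi>] carrier_matD[OF car[OF IH(1)]] by simp
      qed
      show ?thesis
        using sum[OF finite_keys S(4)] sum_monomials[OF finite_keys order_refl, of p] carrier_matD[OF car[OF L(2)]]
        by (intro eq_matI) (simp_all add: index_gsum[OF \<phi> finite_keys order_refl])
    qed
    ultimately show ?thesis using ran_dim_eq_frank[OF car[OF L(2)]] by simp
  qed
  have "\<forall>\<delta>>0. \<exists>\<eta>>0. \<forall>\<epsilon>. 0 < \<epsilon> \<and> \<epsilon> < \<eta> \<longrightarrow>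
    (\<forall>n \<psi>. almost_rep cg_scale L \<epsilon> n \<psi> \<longrightarrow> real (ran_dim n (\<psi> p)) < \<delta> * real n)"
  proof (intro allI impI)
    fix \<delta> :: real assume "0 < \<delta>"
    from small[OF this] obtain e where e: "0 < e" "\<And>n \<phi>. arep n F e \<phi> \<Longrightarrow> frank (gsum n \<phi> p) < \<delta> * real n" by blast
    show "\<exists>\<eta>>0. \<forall>\<epsilon>. 0 < \<epsilon> \<and> \<epsilon> < \<eta> \<longrightarrow>
      (\<forall>n \<psi>. almost_rep cg_scale L \<epsilon> n \<psi> \<longrightarrow> real (ran_dim n (\<psi> p)) < \<delta> * real n)"
      using main[OF e] e(1) by blast
  qed
  with sub L afdr show ?thesis unfolding rank_radical_def by auto
qed

text \<open>This direction is an exchange of quantifiers valid in every algebra: an \<open>L\<close>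
  that serves all \<open>\<delta>\<close> serves each of them.\<close>

lemma rank_radical_subset_sofic_radical: "rank_radical scale \<subseteq> sofic_radical scale"
  unfolding rank_radical_def sofic_radical_def by auto

theorem mainTheorem19:
  shows "sofic_radical (cg_scale :: complex \<Rightarrow> ('g::{group_add, countable} \<Rightarrow>\<^sub>0 complex) \<Rightarrow> _)
       = rank_radical (cg_scale :: complex \<Rightarrow> ('g \<Rightarrow>\<^sub>0 complex) \<Rightarrow> _)"
proof (cases "has_afdr (cg_scale :: complex \<Rightarrow> ('g \<Rightarrow>\<^sub>0 complex) \<Rightarrow> _)")
  case True
  show ?thesis
    using rank_radical_if_rank_null[OF True rank_null_if_not_good[OF not_good_if_sofic[OF True]]]
      rank_radical_subset_sofic_radical by blast
next
  case False
  then show ?thesis by (simp add: sofic_radical_def rank_radical_def)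
qed

end
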